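(* For all $\alpha,\beta\in Z^\bullet$ and for any choice of eigenbases defining $\Upsilon$, one has the equality of cochains $$\Phi^*\big(\Upsilon(\alpha)\smile\Upsilon(\beta)\big)=\alpha\diamond\beta\quad\text{in }C^\bullet .$$ Hence the cup product on $\mathrm{HH}^\bullet(S(V),S(V)\#G)\cong Z^\bullet/B^\bullet$ is given by $[\alpha]\smile[\beta]=[\alpha\diamond\beta]$. Moreover, for $\alpha=f_g\otimes\omega_g\otimes g\in Z^\bullet$ and $\beta=f_h\otimes\omega_h\otimes h\in Z^\bullet$, the cochains $\alpha\diamond\beta$ and $f_gf_h\otimes(\omega_g\wedge\omega_h)\otimes gh$ represent the same class in $Z^\bullet/B^\bullet$; i.e. the cup product on cohomology is induced by the multiplication of the tensor product algebra $(S(V)\otimes\bigwedge^\bullet V^* )\otimes\mathbb C[G]$.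
   Context: Let $G$ be a finite group and $V$ a complex vector space of dimension $n$ on which $G$ acts linearly; fix a $G$-invariant Hermitian inner product on $V$. For $g\in G$ let $V^g$ be the fixed space and $(V^g)^\perp$ its orthogonal complement. $G$ acts on $V^*$ by $({}^g\phi)(v)=\phi({}^{g^{-1}}v)$, hence on $S(V)$ and $\bigwedge V^*$. For $W\subseteq V$, $W^*$ is regarded as the functionals in $V^*$ vanishing on $W^\perp$. $S(V)\#G$ is $S(V)\otimes\mathbb CG$ with $(a\otimes g)(b\otimes h)=a\,{}^gb\otimes gh$. Bar cochains: $\operatorname{Hom}_{\mathbb C}(S(V)^{\otimes p},S(V)\#G)$, with cup product $(F\smile F')(a_1\otimes\cdots\otimes a_{p+q})=F(a_1\otimes\cdots\otimes a_p)F'(a_{p+1}\otimes\cdots\otimes a_{p+q})$ (product in $S(V)\#G$). Koszul cochains: $C^p=\bigoplus_gS(V)\otimes\bigwedge^pV^*\otimes g\cong\operatorname{Hom}_{\mathbb C}(\bigwedge^pV,S(V)\#G)$. $Z^p=\bigoplus_gS(V)\otimes\big(\bigwedge^{p-\operatorname{codim}V^g}(V^g)^*\wedge\bigwedge^{\operatorname{codim}V^g}((V^g)^\perp)^*\big)\otimes g$ and $B^p$ is the same with $S(V)$ replaced by the ideal $I((V^g)^\perp)$ generated by $(V^g)^\perp$; it is known that $\mathrm{HH}^p(S(V),S(V)\#G)\cong Z^p/B^p$. $\Phi^*$: $(\Phi^*F)(u_1\wedge\cdots\wedge u_p)=\sum_{\pi\in\mathrm{Sym}_p}\operatorname{sgn}(\pi)F(u_{\pi(1)}\otimes\cdots\otimes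 u_{\pi(p)})$. $\Upsilon$: for each $g$ fix an eigenbasis $B_g=\{v_1,\dots,v_n\}$ of $g$, ${}^gv_i=\epsilon_iv_i$, dual basis $v_i^*$; let $s_i$ be the diagonal map $v_i\mapsto\epsilon_iv_i$, $v_j\mapsto v_j$ ($j\neq i$); $\partial_i=\partial/\partial v_i$ if $\epsilon_i=1$, else $\partial_i f=(f-{}^{s_i}f)/(v_i-{}^{s_i}v_i)$; for $\alpha=f_g\otimes v_{j_1}^*\wedge\cdots\wedge v_{j_p}^*\otimes g$, $j_1<\cdots<j_p$, $\Upsilon(\alpha)(f_1\otimes\cdots\otimes f_p)=\big(\prod_{k}{}^{s_1\cdots s_{j_k-1}}(\partial_{j_k}f_k)\big)f_g\otimes g$, extended linearly. It is known that $\Upsilon$ is a cochain map and $\Upsilon$, $\Phi^*$ induce mutually inverse isomorphisms between Koszul and bar cohomology, so the Hochschild cup product on $Z^\bullet/B^\bullet$ is $[\alpha]\smile[\beta]=[\Phi^*(\Upsilon(\alpha)\smile\Upsilon(\beta))]$. Smash product: $(f\otimes\omega\otimes g)\diamond(f'\otimes\omega'\otimes h)=f\,{}^gf'\otimes(\omega\wedge{}^g\omega')\otimes gh$. *)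

theory Defs
  imports "HOL-Analysis.Analysis" "HOL-Algebra.Group" "HOL-Combinatorics.Permutations"
begin

text \<open>
Conventions.  V = complex^'n (so n = CARD('n)).  A linear functional on V
(an element of V^* ) is represented by its coordinate vector phi :: complex^'n,
acting by pairing.  S(V) is realised as the algebra of polynomial functions
on V^* (an element v of V is the linear function phi |-> phi(v)); this is
canonically isomorphic to S(V) since the ground field is infinite.
\<close>

type_synonym 'n spoly = "complex^('n::finite) \<Rightarrow> complex"

definition pairing :: "complex^('n::finite) \<Rightarrow> complex^'n \<Rightarrow> complex" where
  "pairing phi v = (\<Sum>i\<in>UNIV. phi $ i * v $ i)"

definition lin :: "complex^'n \<Rightarrow> 'n spoly" where
  "lin v = (\<lambda>phi. pairing phi v)"

inductive_set polys :: "('n::finite) spoly set" where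
  const: "(\<lambda>phi. c) \<in> polys"
| linear: "lin v \<in> polys"
| add: "f \<in> polys \<Longrightarrow> g \<in> polys \<Longrightarrow> (\<lambda>phi. f phi + g phi) \<in> polys"
| mult: "f \<in> polys \<Longrightarrow> g \<in> polys \<Longrightarrow> (\<lambda>phi. f phi * g phi) \<in> polys"

text \<open>Action on S(V) of a linear map T of V (algebra automorphism extending T)\<close>
definition act :: "(complex^'n \<Rightarrow> complex^'n) \<Rightarrow> 'n spoly \<Rightarrow> 'n spoly" where
  "act T f = (\<lambda>phi. f (\<chi> i. pairing phi (T (axis i 1))))"

definition gact :: "('g \<Rightarrow> complex^'n^'n) \<Rightarrow> 'g \<Rightarrow> 'n spoly \<Rightarrow> 'n spoly" where
  "gact \<rho> g f = act (\<lambda>v. \<rho> g *v v) f"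

definition herm_ip :: "complex^'n^'n \<Rightarrow> complex^'n \<Rightarrow> complex^'n \<Rightarrow> complex" where
  "herm_ip Hm v w = (\<Sum>i\<in>UNIV. \<Sum>j\<in>UNIV. cnj (v $ i) * Hm $ i $ j * w $ j)"

definition orth :: "complex^'n^'n \<Rightarrow> (complex^'n) set \<Rightarrow> (complex^'n) set" where
  "orth Hm W = {v. \<forall>w\<in>W. herm_ip Hm w v = 0}"

definition fixsp :: "('g \<Rightarrow> complex^'n^'n) \<Rightarrow> 'g \<Rightarrow> (complex^'n) set" where
  "fixsp \<rho> g = {v. \<rho> g *v v = v}"

definition codim_fix :: "('g \<Rightarrow> complex^'n^'n) \<Rightarrow> 'g \<Rightarrow> nat" where
  "codim_fix \<rho> g = CARD('n) - vec.dim (fixsp \<rho> g)"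

text \<open>W^* = functionals vanishing on the orthogonal complement of W\<close>
definition dualsub :: "complex^'n^'n \<Rightarrow> (complex^'n) set \<Rightarrow> (complex^'n) set" where
  "dualsub Hm W = {phi. \<forall>w\<in>orth Hm W. pairing phi w = 0}"

text \<open>(phi_0 \<and> ... \<and> phi_{p-1})(u_0 \<and> ... \<and> u_{p-1}) = det(phi_i(u_j))\<close>
definition wedgeF :: "(nat \<Rightarrow> complex^'n) \<Rightarrow> nat \<Rightarrow> (nat \<Rightarrow> complex^'n) \<Rightarrow> complex" where
  "wedgeF Phi p u = (\<Sum>\<pi>\<in>{\<pi>. \<pi> permutes {..<p}}.
       of_int (sign \<pi>) * (\<Prod>i<p. pairing (Phi i) (u (\<pi> i))))"

text \<open>the elements of Lambda^p V^*, as alternating p-forms on V\<close>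
definition extp :: "nat \<Rightarrow> ((nat \<Rightarrow> complex^'n) \<Rightarrow> complex) set" where
  "extp p = {\<omega>. \<exists>(M::nat) c Phi. \<omega> = (\<lambda>u. \<Sum>m<M. c m * wedgeF (Phi m) p u)}"

definition wedgeS :: "nat \<Rightarrow> nat \<Rightarrow> ((nat \<Rightarrow> complex^'n) \<Rightarrow> complex)
     \<Rightarrow> ((nat \<Rightarrow> complex^'n) \<Rightarrow> complex) \<Rightarrow> (nat \<Rightarrow> complex^'n) \<Rightarrow> complex" where
  "wedgeS p q \<omega> \<eta> u = (1 / (of_nat (fact p * fact q))) *
     (\<Sum>\<pi>\<in>{\<pi>. \<pi> permutes {..<p+q}}.
        of_int (sign \<pi>) * \<omega> (\<lambda>i. u (\<pi> i)) * \<eta> (\<lambda>i. u (\<pi> (i + p))))"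

text \<open>A Koszul p-cochain is a map alpha :: 'g => (nat => V) => S(V); alpha g is the
  component in S(V) \<otimes> Lambda^p V^* \<otimes> g, viewed as an alternating p-form with
  values in S(V) (only the first p arguments matter).  This is the identification
  C^p = Hom(Lambda^p V, S(V)#G).\<close>

type_synonym ('g,'n) kcochain = "'g \<Rightarrow> (nat \<Rightarrow> complex^'n) \<Rightarrow> 'n spoly"

definition Zg :: "('g \<Rightarrow> complex^'n^'n) \<Rightarrow> complex^'n^'n \<Rightarrow> 'n spoly set \<Rightarrow> 'g \<Rightarrow> nat
     \<Rightarrow> ((nat \<Rightarrow> complex^'n) \<Rightarrow> 'n spoly) set" where
  "Zg \<rho> Hm R g p = {A. \<exists>(M::nat) f Phi.
      (\<forall>m<M. codim_fix \<rho> g \<le> p \<and> f m \<in> R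
         \<and> (\<forall>i<p - codim_fix \<rho> g. Phi m i \<in> dualsub Hm (fixsp \<rho> g))
         \<and> (\<forall>i. p - codim_fix \<rho> g \<le> i \<and> i < p \<longrightarrow> Phi m i \<in> dualsub Hm (orth Hm (fixsp \<rho> g))))
      \<and> A = (\<lambda>u phi. \<Sum>m<M. f m phi * wedgeF (Phi m) p u)}"

definition idealI :: "complex^'n^'n \<Rightarrow> (complex^'n) set \<Rightarrow> 'n spoly set" where
  "idealI Hm W = {r. \<exists>(K::nat) rs ws. (\<forall>k<K. rs k \<in> polys \<and> ws k \<in> W)
      \<and> r = (\<lambda>phi. \<Sum>k<K. rs k phi * lin (ws k) phi)}"

definition Zset :: "'g monoid \<Rightarrow> ('g \<Rightarrow> complex^'n^'n) \<Rightarrow> complex^'n^'n \<Rightarrow> nat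
     \<Rightarrow> ('g,'n) kcochain set" where
  "Zset G \<rho> Hm p = {\<alpha>. \<forall>g\<in>carrier G. \<alpha> g \<in> Zg \<rho> Hm polys g p}"

definition Bset :: "'g monoid \<Rightarrow> ('g \<Rightarrow> complex^'n^'n) \<Rightarrow> complex^'n^'n \<Rightarrow> nat
     \<Rightarrow> ('g,'n) kcochain set" where
  "Bset G \<rho> Hm p = {\<alpha>. \<forall>g\<in>carrier G.
       \<alpha> g \<in> Zg \<rho> Hm (idealI Hm (orth Hm (fixsp \<rho> g))) g p}"

definition gactK :: "'g monoid \<Rightarrow> ('g \<Rightarrow> complex^'n^'n) \<Rightarrow> 'g
     \<Rightarrow> ((nat \<Rightarrow> complex^'n) \<Rightarrow> 'n spoly) \<Rightarrow> (nat \<Rightarrow> complex^'n) \<Rightarrow> 'n spoly" where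
  "gactK G \<rho> g A u = gact \<rho> g (A (\<lambda>i. \<rho> (inv\<^bsub>G\<^esub> g) *v u i))"

text \<open>(f\<otimes>\<omega>) \<and>_g (f'\<otimes>\<omega>') = f f' \<otimes> \<omega>\<and>\<omega>', extended bilinearly\<close>
definition wedgeK :: "nat \<Rightarrow> nat \<Rightarrow> ((nat \<Rightarrow> complex^'n) \<Rightarrow> 'n spoly)
     \<Rightarrow> ((nat \<Rightarrow> complex^'n) \<Rightarrow> 'n spoly) \<Rightarrow> (nat \<Rightarrow> complex^'n) \<Rightarrow> 'n spoly" where
  "wedgeK p q A A' u = (\<lambda>phi. (1 / (of_nat (fact p * fact q))) *
     (\<Sum>\<pi>\<in>{\<pi>. \<pi> permutes {..<p+q}}.
        of_int (sign \<pi>) * A (\<lambda>i. u (\<pi> i)) phi * A' (\<lambda>i. u (\<pi> (i + p))) phi))"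

definition diamond :: "'g monoid \<Rightarrow> ('g \<Rightarrow> complex^'n^'n) \<Rightarrow> nat \<Rightarrow> nat
     \<Rightarrow> ('g,'n) kcochain \<Rightarrow> ('g,'n) kcochain \<Rightarrow> ('g,'n) kcochain" where
  "diamond G \<rho> p q \<alpha> \<beta> = (\<lambda>k u phi. \<Sum>g\<in>carrier G.
       wedgeK p q (\<alpha> g) (gactK G \<rho> g (\<beta> (inv\<^bsub>G\<^esub> g \<otimes>\<^bsub>G\<^esub> k))) u phi)"

text \<open>An element of S(V)#G is a map 'g => S(V) (coefficient of each group element);
  a bar p-cochain is a map (nat => S(V)) => S(V)#G (first p arguments matter).\<close>

type_synonym ('g,'n) bcochain = "(nat \<Rightarrow> 'n spoly) \<Rightarrow> 'g \<Rightarrow> 'n spoly"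

definition smash_mult :: "'g monoid \<Rightarrow> ('g \<Rightarrow> complex^'n^'n)
     \<Rightarrow> ('g \<Rightarrow> 'n spoly) \<Rightarrow> ('g \<Rightarrow> 'n spoly) \<Rightarrow> 'g \<Rightarrow> 'n spoly" where
  "smash_mult G \<rho> x y = (\<lambda>k phi. \<Sum>g\<in>carrier G.
       x g phi * gact \<rho> g (y (inv\<^bsub>G\<^esub> g \<otimes>\<^bsub>G\<^esub> k)) phi)"

definition cupb :: "'g monoid \<Rightarrow> ('g \<Rightarrow> complex^'n^'n) \<Rightarrow> nat
     \<Rightarrow> ('g,'n) bcochain \<Rightarrow> ('g,'n) bcochain \<Rightarrow> ('g,'n) bcochain" where
  "cupb G \<rho> p F F' = (\<lambda>a. smash_mult G \<rho> (F a) (F' (\<lambda>i. a (i + p))))"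

definition PhiStar :: "nat \<Rightarrow> ('g,'n) bcochain \<Rightarrow> (nat \<Rightarrow> complex^'n) \<Rightarrow> 'g \<Rightarrow> 'n spoly" where
  "PhiStar p F u = (\<lambda>k phi. \<Sum>\<pi>\<in>{\<pi>. \<pi> permutes {..<p}}.
       of_int (sign \<pi>) * F (\<lambda>i. lin (u (\<pi> i))) k phi)"

definition eigenbases :: "'g monoid \<Rightarrow> ('g \<Rightarrow> complex^'n^'n) \<Rightarrow> ('g \<Rightarrow> nat \<Rightarrow> complex^'n) \<Rightarrow> bool" where
  "eigenbases G \<rho> b \<longleftrightarrow> (\<forall>g\<in>carrier G.
      (\<forall>i<CARD('n). \<exists>\<epsilon>. \<rho> g *v b g i = \<epsilon> *s b g i)
    \<and> (\<forall>c. (\<Sum>i<CARD('n). c i *s b g i) = 0 \<longrightarrow> (\<forall>i<CARD('n). c i = 0))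
    \<and> (\<forall>v. \<exists>c. v = (\<Sum>i<CARD('n). c i *s b g i)))"

definition eigval :: "('g \<Rightarrow> complex^'n^'n) \<Rightarrow> ('g \<Rightarrow> nat \<Rightarrow> complex^'n) \<Rightarrow> 'g \<Rightarrow> nat \<Rightarrow> complex" where
  "eigval \<rho> b g i = (THE \<epsilon>. \<rho> g *v b g i = \<epsilon> *s b g i)"

definition dualb :: "('g \<Rightarrow> nat \<Rightarrow> complex^'n) \<Rightarrow> 'g \<Rightarrow> nat \<Rightarrow> complex^'n" where
  "dualb b g i = (THE phi. \<forall>j<CARD('n). pairing phi (b g j) = (if i = j then 1 else 0))"

definition diagmap :: "('g \<Rightarrow> complex^'n^'n) \<Rightarrow> ('g \<Rightarrow> nat \<Rightarrow> complex^'n) \<Rightarrow> 'g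
     \<Rightarrow> (nat \<Rightarrow> bool) \<Rightarrow> complex^'n \<Rightarrow> complex^'n" where
  "diagmap \<rho> b g P v = (\<Sum>j<CARD('n).
      ((if P j then eigval \<rho> b g j else 1) * pairing (dualb b g j) v) *s b g j)"

definition srefl where "srefl \<rho> b g i = diagmap \<rho> b g (\<lambda>j. j = i)"

text \<open>s_0 ... s_{i-1} (0-based indices)\<close>
definition sprefix where "sprefix \<rho> b g i = diagmap \<rho> b g (\<lambda>j. j < i)"

definition qpartial :: "('g \<Rightarrow> complex^'n^'n) \<Rightarrow> ('g \<Rightarrow> nat \<Rightarrow> complex^'n) \<Rightarrow> 'g \<Rightarrow> nat
     \<Rightarrow> 'n spoly \<Rightarrow> 'n spoly" where
  "qpartial \<rho> b g i f =
     (if eigval \<rho> b g i = 1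
      then (\<lambda>phi. deriv (\<lambda>t. f (phi + t *s dualb b g i)) 0)
      else (THE q. q \<in> polys \<and> (\<forall>phi. q phi *
               (lin (b g i) phi - act (srefl \<rho> b g i) (lin (b g i)) phi)
             = f phi - act (srefl \<rho> b g i) f phi)))"

definition jth :: "nat set \<Rightarrow> nat \<Rightarrow> nat" where
  "jth J k = sorted_list_of_set J ! k"

text \<open>Upsilon, extended linearly: alpha g = sum_J alpha g (v_J) v_J^*, J increasing\<close>
definition Upsilon :: "'g monoid \<Rightarrow> ('g \<Rightarrow> complex^'n^'n) \<Rightarrow> ('g \<Rightarrow> nat \<Rightarrow> complex^'n)
     \<Rightarrow> nat \<Rightarrow> ('g,'n) kcochain \<Rightarrow> ('g,'n) bcochain" where
  "Upsilon G \<rho> b p \<alpha> = (\<lambda>fs g phi.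
     if g \<in> carrier G then
       (\<Sum>J\<in>{J. J \<subseteq> {..<CARD('n)} \<and> card J = p}.
          (\<Prod>k<p. act (sprefix \<rho> b g (jth J k)) (qpartial \<rho> b g (jth J k) (fs k)) phi)
          * \<alpha> g (\<lambda>k. b g (jth J k)) phi)
     else 0)"

end

theory Submission
  imports Defs
begin

text \<open>
  On linear polynomials every quantum partial derivative is the constant given by the dual basis
  vector, so antisymmetrising \<open>\<Upsilon>(\<alpha>) \<smile> \<Upsilon>(\<beta>)\<close> expands each factor in dual bases and returns
  the plain products \<open>f\<^sub>g \<^sup>gf\<^sub>h \<otimes> (\<omega>\<^sub>g \<and> \<omega>\<^sub>h) \<otimes> gh\<close>, with no action of \<open>g\<close> on \<open>\<omega>\<^sub>h\<close>.  The action
  on \<open>\<omega>\<^sub>h\<close> makes no difference: \<open>\<^sup>g\<phi> - \<phi>\<close> annihilates \<open>V\<^sup>g\<close>, and \<open>\<omega>\<^sub>g\<close> is divisible by a top form on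
  the annihilator of \<open>V\<^sup>g\<close>.  If \<open>\<omega>\<^sub>g \<and> \<omega>\<^sub>h \<noteq> 0\<close> then the annihilators of \<open>V\<^sup>g\<close> and \<open>V\<^sup>h\<close> are
  independent, which forces \<open>V\<^sup>g\<^sup>h = V\<^sup>g \<inter> V\<^sup>h\<close> and makes the codimensions add; hence the product is
  in \<open>Z\<close>.  Finally \<open>\<^sup>gf - f\<close> lies in the ideal of \<open>(V\<^sup>g)\<^sup>\<bottom> \<subseteq> (V\<^sup>g\<^sup>h)\<^sup>\<bottom>\<close>, so replacing \<open>\<^sup>gf\<^sub>h\<close> by
  \<open>f\<^sub>h\<close> changes the product by an element of \<open>B\<close>.
\<close>

section \<open>Determinantal forms\<close>

lemma pairing_add_left: "pairing (x + y) v = pairing x v + pairing y v"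
  by (simp add: pairing_def sum.distrib algebra_simps)

lemma pairing_diff_left: "pairing (x - y) v = pairing x v - pairing y v"
  by (simp add: pairing_def sum_subtractf algebra_simps)

lemma pairing_scale_left: "pairing (c *s x) v = c * pairing x v"
  by (simp add: pairing_def sum_distrib_left algebra_simps)

lemma pairing_zero_left [simp]: "pairing 0 v = 0"
  by (simp add: pairing_def)

lemma pairing_sum_left: "pairing (\<Sum>i\<in>I. x i) v = (\<Sum>i\<in>I. pairing (x i) v)"
  by (induction I rule: infinite_finite_induct) (simp_all add: pairing_add_left)

lemma pairing_add_right: "pairing x (v + w) = pairing x v + pairing x w"
  by (simp add: pairing_def sum.distrib algebra_simps)

lemma pairing_diff_right: "pairing x (v - w) = pairing x v - pairing x w"
  by (simp add: pairing_def sum_subtractf algebra_simps)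

lemma pairing_scale_right: "pairing x (c *s v) = c * pairing x v"
  by (simp add: pairing_def sum_distrib_left algebra_simps)

lemma pairing_zero_right [simp]: "pairing x 0 = 0"
  by (simp add: pairing_def)

lemma pairing_sum_right: "pairing x (\<Sum>i\<in>I. v i) = (\<Sum>i\<in>I. pairing x (v i))"
  by (induction I rule: infinite_finite_induct) (simp_all add: pairing_add_right)

lemma pairing_axis [simp]: "pairing phi (axis i 1) = phi $ i"
  by (simp add: pairing_def axis_def if_distrib cong: if_cong)

lemma pairing_eqI: "(\<And>v. pairing x v = pairing y v) \<Longrightarrow> x = y"
  by (metis pairing_axis vec_eq_iff)

text \<open>The row vector \<open>x v* A\<close> is the pullback of the functional \<open>x\<close>
  along \<open>A\<close>. With \<open>A = \<rho> (inv g)\<close> this is the action of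
  \<open>g\<close> on functionals.\<close>

lemma pairing_matrix: "pairing x (A *v v) = pairing (x v* A) v"
  unfolding pairing_def matrix_vector_mult_def vector_matrix_mult_def
  by (simp add: sum_distrib_left sum_distrib_right, subst sum.swap)
    (intro sum.cong refl, simp add: mult_ac)

section \<open>Alternation, multilinearity and vanishing of determinantal forms\<close>

lemma wedgeF_cong:
  assumes "\<And>i. i < p \<Longrightarrow> Phi i = Phi' i" "\<And>i. i < p \<Longrightarrow> u i = u' i"
  shows "wedgeF Phi p u = wedgeF Phi' p u'"
  unfolding wedgeF_def
proof (intro sum.cong refl arg_cong2[where f = "(*)"] prod.cong)
  fix \<pi> i assume "\<pi> \<in> {\<pi>. \<pi> permutes {..<p}}" "i \<in> {..<p}"
  then show "pairing (Phi i) (u (\<pi> i)) = pairing (Phi' i) (u' (\<pi> i))"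
    using assms permutes_in_image[of \<pi> "{..<p}" i] by auto
qed

lemma sum_permutes_shift:
  assumes "\<sigma> permutes S"
  shows "(\<Sum>\<pi>\<in>{\<pi>. \<pi> permutes S}. f (\<pi> \<circ> \<sigma>)) = (\<Sum>\<pi>\<in>{\<pi>. \<pi> permutes S}. f \<pi>)"
  using sum_permutations_compose_right[OF assms] by metis

lemma sign_comp_permutes:
  assumes "finite S" "\<pi> permutes S" "\<sigma> permutes S"
  shows "sign (\<pi> \<circ> \<sigma>) = sign \<pi> * sign \<sigma>"
  using assms permutation_permutes sign_compose by blast

text \<open>Reindexing the product over slots by \<open>\<sigma>\<close> turns \<open>\<pi>\<close>
  into \<open>\<pi> \<circ> \<sigma>\<close>, and right translation by \<open>\<sigma>\<close> runs
  through the same permutations.\<close>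

lemma wedgeF_permute_forms:
  assumes "\<sigma> permutes {..<p}"
  shows "wedgeF (\<lambda>i. Phi (\<sigma> i)) p u = of_int (sign \<sigma>) * wedgeF Phi p u"
proof -
  have "(\<Prod>i<p. pairing (Phi i) (u (\<pi> i))) = (\<Prod>i<p. pairing (Phi (\<sigma> i)) (u ((\<pi> \<circ> \<sigma>) i)))"
    for \<pi>
    using prod.permute[OF assms, of "\<lambda>i. pairing (Phi i) (u (\<pi> i))"] by (simp add: o_def)
  then have "of_int (sign \<sigma>) * wedgeF Phi p u = (\<Sum>\<pi>\<in>{\<pi>. \<pi> permutes {..<p}}.
       of_int (sign (\<pi> \<circ> \<sigma>)) * (\<Prod>i<p. pairing (Phi (\<sigma> i)) (u ((\<pi> \<circ> \<sigma>) i))))"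
    unfolding wedgeF_def sum_distrib_left
    by (intro sum.cong refl) (simp add: sign_comp_permutes[OF _ _ assms])
  also have "\<dots> = wedgeF (\<lambda>i. Phi (\<sigma> i)) p u"
    unfolding wedgeF_def
    by (rule sum_permutes_shift[OF assms, where f = "\<lambda>\<pi>. of_int (sign \<pi>) *
         (\<Prod>i<p. pairing (Phi (\<sigma> i)) (u (\<pi> i)))"])
  finally show ?thesis by simp
qed

lemma prod_upd_slot:
  fixes j p :: nat
  assumes "j < p"
  shows "(\<Prod>i<p. pairing ((Phi(j := x)) i) (w i))
    = pairing x (w j) * (\<Prod>i\<in>{..<p} - {j}. pairing (Phi i) (w i))"
proof -
  have "(\<Prod>i<p. pairing ((Phi(j := x)) i) (w i))
    = pairing ((Phi(j := x)) j) (w j) * (\<Prod>i\<in>{..<p} - {j}. pairing ((Phi(j := x)) i) (w i))"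
    using assms by (intro prod.remove) simp_all
  also have "(\<Prod>i\<in>{..<p} - {j}. pairing ((Phi(j := x)) i) (w i))
    = (\<Prod>i\<in>{..<p} - {j}. pairing (Phi i) (w i))"
    by (intro prod.cong) auto
  finally show ?thesis by simp
qed

lemma wedgeF_add_slot:
  assumes "j < p"
  shows "wedgeF (Phi(j := x + y)) p u = wedgeF (Phi(j := x)) p u + wedgeF (Phi(j := y)) p u"
  unfolding wedgeF_def prod_upd_slot[OF assms]
  by (simp add: pairing_add_left algebra_simps sum.distrib)

lemma wedgeF_scale_slot:
  assumes "j < p"
  shows "wedgeF (Phi(j := c *s x)) p u = c * wedgeF (Phi(j := x)) p u"
  unfolding wedgeF_def prod_upd_slot[OF assms]
  by (simp add: pairing_scale_left sum_distrib_left algebra_simps)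

lemma wedgeF_zero_slot:
  assumes "j < p"
  shows "wedgeF (Phi(j := 0)) p u = 0"
  using wedgeF_scale_slot[OF assms, of Phi 0 0 u] by simp

text \<open>Swapping two equal slots leaves the family unchanged and reverses the sign, so the value
  is its own negative.\<close>

lemma wedgeF_repeat:
  assumes "i < p" "j < p" "i \<noteq> j" "Phi i = Phi j"
  shows "wedgeF Phi p u = 0"
proof -
  have t: "Transposition.transpose i j permutes {..<p}"
    using assms by (simp add: permutes_swap_id)
  have "(\<lambda>k. Phi (Transposition.transpose i j k)) = Phi"
    using assms by (auto simp: Transposition.transpose_def)
  then have "wedgeF Phi p u = - wedgeF Phi p u"
    using wedgeF_permute_forms[OF t, of Phi u] assms by (simp add: sign_swap_id)
  then show ?thesis by simp
qed

text \<open>With the other slots fixed, the vectors that make the determinant vanish form a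
  subspace. It contains each \<open>Phi s\<close>, which would be a repeated slot.\<close>

lemma wedgeF_slot_in_span:
  assumes "S \<subseteq> {..<p}" "j < p" "j \<notin> S" "x \<in> vec.span (Phi ` S)"
  shows "wedgeF (Phi(j := x)) p u = 0"
proof -
  let ?T = "{x. wedgeF (Phi(j := x)) p u = 0}"
  have "vec.subspace ?T"
    unfolding vec.subspace_def using assms(2)
    by (auto simp: wedgeF_add_slot wedgeF_scale_slot wedgeF_zero_slot)
  moreover have "Phi ` S \<subseteq> ?T"
  proof safe
    fix s assume "s \<in> S"
    then show "wedgeF (Phi(j := Phi s)) p u = 0"
      using assms by (intro wedgeF_repeat[of s p j]) auto
  qed
  ultimately show ?thesis
    using vec.span_minimal assms(4) by blast
qed

text \<open>More than \<open>dim W\<close> slots with values in \<open>W\<close> are linearly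
  dependent, so one of them lies in the span of the others.\<close>

lemma wedgeF_eq_0_of_dim:
  assumes "S \<subseteq> {..<p}" "\<And>s. s \<in> S \<Longrightarrow> Phi s \<in> W" "vec.dim W < card S"
  shows "wedgeF Phi p u = 0"
proof -
  \<comment> \<open>Dependence is needed for the indexed family, not for its set of values: a
    repeated value leaves the set possibly independent, so the non-injective case is treated
    apart.\<close>
  have "\<exists>j\<in>S. Phi j \<in> vec.span (Phi ` (S - {j}))"
  proof (cases "inj_on Phi S")
    case True
    have "vec.dependent (Phi ` S)"
    proof (rule ccontr)
      assume "vec.independent (Phi ` S)"
      then have "card (Phi ` S) \<le> vec.dim W"
        using assms(2) by (intro vec.independent_card_le_dim) auto
      then show False using assms(3) card_image[OF True] by simp
    qed
    then obtain j where j: "j \<in> S" "Phi j \<in> vec.span (Phi ` S - {Phi j})"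
      unfolding vec.dependent_def by auto
    have "Phi ` S - {Phi j} \<subseteq> Phi ` (S - {j})" by auto
    then show ?thesis using j vec.span_mono by blast
  next
    case False
    then obtain i j where "i \<in> S" "j \<in> S" "i \<noteq> j" "Phi i = Phi j"
      unfolding inj_on_def by auto
    then have "Phi j \<in> Phi ` (S - {j})"
      by (intro image_eqI[of _ _ i]) auto
    then have "Phi j \<in> vec.span (Phi ` (S - {j}))"
      by (rule vec.span_base)
    then show ?thesis using \<open>j \<in> S\<close> by auto
  qed
  then obtain j where "j \<in> S" "Phi j \<in> vec.span (Phi ` (S - {j}))" by auto
  then have "wedgeF (Phi(j := Phi j)) p u = 0"
    using assms(1) by (intro wedgeF_slot_in_span[of "S - {j}"]) auto
  then show ?thesis by simp
qed

text \<open>The slots in \<open>S\<close> already exhaust \<open>W\<close>. Changing one further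
  slot by an element of \<open>W\<close> alters the determinant by one with more than
  \<open>dim W\<close> slots in \<open>W\<close>, which is zero. The remaining slots are changed one
  at a time.\<close>

lemma wedgeF_absorb:
  assumes "S \<subseteq> {..<p}" "\<And>s. s \<in> S \<Longrightarrow> Phi s \<in> W" "vec.dim W \<le> card S"
    and "\<And>s. s \<in> S \<Longrightarrow> Psi s = Phi s" "\<And>i. i < p \<Longrightarrow> Psi i - Phi i \<in> W"
  shows "wedgeF Psi p u = wedgeF Phi p u"
proof -
  have fS: "finite S" using assms(1) finite_subset by blast
  have step: "wedgeF (\<lambda>i. if i \<in> T then Psi i else Phi i) p u = wedgeF Phi p u"
    if "finite T" "T \<subseteq> {..<p} - S" for T
    using that
  proof (induction T rule: finite_induct)
    case empty
    then show ?case by simp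
  next
    case (insert j T)
    let ?X = "\<lambda>i. if i \<in> T then Psi i else Phi i"
    have j: "j < p" "j \<notin> S" using insert by auto
    have "wedgeF (?X(j := Psi j - Phi j)) p u = 0"
    proof (rule wedgeF_eq_0_of_dim)
      show "insert j S \<subseteq> {..<p}" using j assms(1) by auto
      show "(?X(j := Psi j - Phi j)) s \<in> W" if "s \<in> insert j S" for s
        using that assms(2,5) j insert.prems by auto
      show "vec.dim W < card (insert j S)" using assms(3) j fS by simp
    qed
    then have "wedgeF (?X(j := Phi j + (Psi j - Phi j))) p u = wedgeF (?X(j := Phi j)) p u"
      unfolding wedgeF_add_slot[OF j(1)] by simp
    moreover have "(\<lambda>i. if i \<in> insert j T then Psi i else Phi i) = ?X(j := Phi j + (Psi j - Phi j))"
      by auto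
    moreover have "?X(j := Phi j) = ?X"
      using insert by auto
    ultimately show ?case using insert by auto
  qed
  have "wedgeF Psi p u = wedgeF (\<lambda>i. if i \<in> {..<p} - S then Psi i else Phi i) p u"
    using assms(4) by (intro wedgeF_cong) auto
  then show ?thesis using step[of "{..<p} - S"] by auto
qed

section \<open>Antisymmetrised products and the wedge of determinantal forms\<close>

lemma mult_sum_product:
  fixes a :: "'a :: comm_semiring_0"
  shows "a * sum f A * sum g B = (\<Sum>x\<in>A. \<Sum>y\<in>B. a * f x * g y)"
  by (simp only: mult.assoc sum_product) (simp only: sum_distrib_left)

text \<open>The two inner sums antisymmetrise the blocks separately; absorbing the block permutations
  into the outer one leaves \<open>p! q!\<close> equal copies of the plain antisymmetrisation.\<close>
lemma alternating_product:
  fixes F F' :: "(nat \<Rightarrow> 'a) \<Rightarrow> complex"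
  assumes F: "\<And>u v. (\<And>i. i < p \<Longrightarrow> u i = v i) \<Longrightarrow> F u = F v"
  shows "(\<Sum>\<pi>\<in>{\<pi>. \<pi> permutes {..<p+q}}. of_int (sign \<pi>)
      * (\<Sum>\<sigma>\<in>{\<sigma>. \<sigma> permutes {..<p}}. of_int (sign \<sigma>) * F (\<lambda>i. u (\<pi> (\<sigma> i))))
      * (\<Sum>\<tau>\<in>{\<tau>. \<tau> permutes {..<q}}. of_int (sign \<tau>) * F' (\<lambda>i. u (\<pi> (\<tau> i + p)))))
    = of_nat (fact p * fact q) * (\<Sum>\<pi>\<in>{\<pi>. \<pi> permutes {..<p+q}}. of_int (sign \<pi>)
      * F (\<lambda>i. u (\<pi> i)) * F' (\<lambda>i. u (\<pi> (i + p))))"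
proof -
  let ?P = "\<lambda>m. {\<pi>. \<pi> permutes {..<m::nat}}"
  let ?t = "\<lambda>\<pi>. of_int (sign \<pi>) * F (\<lambda>i. u (\<pi> i)) * F' (\<lambda>i. u (\<pi> (i + p)))"
  have "(\<Sum>\<pi>\<in>?P (p + q). of_int (sign \<pi>)
      * (\<Sum>\<sigma>\<in>?P p. of_int (sign \<sigma>) * F (\<lambda>i. u (\<pi> (\<sigma> i))))
      * (\<Sum>\<tau>\<in>?P q. of_int (sign \<tau>) * F' (\<lambda>i. u (\<pi> (\<tau> i + p)))))
    = (\<Sum>\<pi>\<in>?P (p + q). \<Sum>\<sigma>\<in>?P p. \<Sum>\<tau>\<in>?P q. of_int (sign \<pi>)
      * (of_int (sign \<sigma>) * F (\<lambda>i. u (\<pi> (\<sigma> i))))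
      * (of_int (sign \<tau>) * F' (\<lambda>i. u (\<pi> (\<tau> i + p)))))"
    unfolding mult_sum_product ..
  also have "\<dots> = (\<Sum>\<sigma>\<in>?P p. \<Sum>\<tau>\<in>?P q. \<Sum>\<pi>\<in>?P (p + q). of_int (sign \<pi>)
      * (of_int (sign \<sigma>) * F (\<lambda>i. u (\<pi> (\<sigma> i))))
      * (of_int (sign \<tau>) * F' (\<lambda>i. u (\<pi> (\<tau> i + p)))))"
    by (rule trans[OF sum.swap]) (intro sum.cong refl sum.swap)
  also have "\<dots> = (\<Sum>\<sigma>\<in>?P p. \<Sum>\<tau>\<in>?P q. \<Sum>\<pi>\<in>?P (p + q). ?t \<pi>)"
  proof (rule sum.cong[OF refl], rule sum.cong[OF refl])
    fix \<sigma> \<tau> assume "\<sigma> \<in> ?P p" "\<tau> \<in> ?P q"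
    then have \<sigma>: "\<sigma> permutes {..<p}" and \<tau>: "\<tau> permutes {..<q}" by auto
    \<comment> \<open>\<open>\<tau>'\<close> is \<open>\<tau>\<close> transported to the second
      block of indices, so that \<open>\<sigma> \<circ> \<tau>'\<close> acts as
      \<open>\<sigma>\<close> on the first block and as the shifted \<open>\<tau>\<close> on the
      second.\<close>
    define \<tau>' where "\<tau>' = map_permutation {..<q} (\<lambda>i. i + p) \<tau>"
    have bij: "bij_betw (\<lambda>i. i + p) {..<q} {p..<p+q}"
      by (rule bij_betw_byWitness[where f' = "\<lambda>i. i - p"]) auto
    have \<tau>'p: "\<tau>' permutes {p..<p+q}"
      unfolding \<tau>'_def by (rule map_permutation_permutes[OF bij \<tau>])
    then have \<tau>'perm: "\<tau>' permutes {..<p+q}"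
      by (rule permutes_subset) auto
    have \<sigma>perm: "\<sigma> permutes {..<p+q}"
      using \<sigma> by (rule permutes_subset) auto
    have s\<tau>: "sign \<tau>' = sign \<tau>"
      unfolding \<tau>'_def using \<tau> by (intro sign_map_permutation) auto
    let ?\<kappa> = "\<sigma> \<circ> \<tau>'"
    have \<kappa>: "?\<kappa> permutes {..<p+q}"
      using permutes_compose[OF \<tau>'perm \<sigma>perm] .
    have \<kappa>1: "?\<kappa> i = \<sigma> i" if "i < p" for i
      using \<tau>'p that by (simp add: permutes_not_in)
    have \<tau>'2: "\<tau>' (i + p) = \<tau> i + p" for i
    proof (cases "i < q")
      case True
      then show ?thesis
        unfolding \<tau>'_def by (intro map_permutation_apply) auto
    next
      case False
      then show ?thesis using \<tau>'p \<tau> by (simp add: permutes_not_in)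
    qed
    \<comment> \<open>This identity holds for every \<open>i\<close>, so the arguments of
      \<open>F'\<close> agree as whole functions. Those of \<open>F\<close> agree only below
      \<open>p\<close>, which is where the locality hypothesis on \<open>F\<close> enters.\<close>
    have \<kappa>2: "?\<kappa> (i + p) = \<tau> i + p" for i
      using \<tau>'2 \<sigma> by (simp add: permutes_not_in)
    have "(\<Sum>\<pi>\<in>?P (p + q). of_int (sign \<pi>) * (of_int (sign \<sigma>) * F (\<lambda>i. u (\<pi> (\<sigma> i))))
      * (of_int (sign \<tau>) * F' (\<lambda>i. u (\<pi> (\<tau> i + p)))))
      = (\<Sum>\<pi>\<in>?P (p + q). ?t (\<pi> \<circ> ?\<kappa>))"
    proof (intro sum.cong refl)
      fix \<pi> assume "\<pi> \<in> ?P (p + q)"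
      then have sg: "sign (\<pi> \<circ> ?\<kappa>) = sign \<pi> * (sign \<sigma> * sign \<tau>)"
        using sign_comp_permutes[OF _ _ \<kappa>, of \<pi>] sign_comp_permutes[OF _ \<sigma>perm \<tau>'perm] s\<tau>
        by auto
      have "F (\<lambda>i. u (\<pi> (\<sigma> i))) = F (\<lambda>i. u ((\<pi> \<circ> ?\<kappa>) i))"
        using \<kappa>1 by (intro F) simp
      moreover have "(\<lambda>i. u (\<pi> (\<tau> i + p))) = (\<lambda>i. u ((\<pi> \<circ> ?\<kappa>) (i + p)))"
        using \<kappa>2 by simp
      ultimately show "of_int (sign \<pi>) * (of_int (sign \<sigma>) * F (\<lambda>i. u (\<pi> (\<sigma> i))))
        * (of_int (sign \<tau>) * F' (\<lambda>i. u (\<pi> (\<tau> i + p)))) = ?t (\<pi> \<circ> ?\<kappa>)"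
        unfolding sg by (simp add: mult_ac)
    qed
    also have "\<dots> = (\<Sum>\<pi>\<in>?P (p + q). ?t \<pi>)"
      by (rule sum_permutes_shift[OF \<kappa>])
    finally show "(\<Sum>\<pi>\<in>?P (p + q). of_int (sign \<pi>) * (of_int (sign \<sigma>) * F (\<lambda>i. u (\<pi> (\<sigma> i))))
      * (of_int (sign \<tau>) * F' (\<lambda>i. u (\<pi> (\<tau> i + p))))) = (\<Sum>\<pi>\<in>?P (p + q). ?t \<pi>)" .
  qed
  also have "\<dots> = of_nat (fact p * fact q) * (\<Sum>\<pi>\<in>?P (p + q). ?t \<pi>)"
    by (simp add: card_permutations[OF refl])
  finally show ?thesis .
qed

definition concat_forms :: "nat \<Rightarrow> (nat \<Rightarrow> 'a) \<Rightarrow> (nat \<Rightarrow> 'a) \<Rightarrow> nat \<Rightarrow> 'a" where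
  "concat_forms p Phi Psi i = (if i < p then Phi i else Psi (i - p))"

text \<open>Take the bare products of pairings for the two functions in
  \<open>alternating_product\<close>: the inner antisymmetrisations become the two determinants, the
  outer one the determinant of the concatenated family. The factor \<open>p! q!\<close> is the one
  that \<open>wedgeS\<close> and \<open>wedgeK\<close> divide out.\<close>

lemma wedge_product:
  "(\<Sum>\<pi>\<in>{\<pi>. \<pi> permutes {..<p+q}}. of_int (sign \<pi>) * wedgeF Phi p (\<lambda>i. u (\<pi> i))
      * wedgeF Psi q (\<lambda>i. u (\<pi> (i + p))))
    = of_nat (fact p * fact q) * wedgeF (concat_forms p Phi Psi) (p + q) u"
proof -
  let ?F = "\<lambda>w. \<Prod>i<p. pairing (Phi i) (w i)" and ?G = "\<lambda>w. \<Prod>i<q. pairing (Psi i) (w i)"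
  have split: "(\<Prod>i<p+q. pairing (concat_forms p Phi Psi i) (w i)) = ?F w * ?G (\<lambda>i. w (i + p))"
    for w :: "nat \<Rightarrow> complex^'a"
  proof -
    have "(\<Prod>i<p+q. pairing (concat_forms p Phi Psi i) (w i))
      = (\<Prod>i<p. pairing (concat_forms p Phi Psi i) (w i))
        * (\<Prod>i\<in>{p..<p+q}. pairing (concat_forms p Phi Psi i) (w i))"
      by (subst prod.union_disjoint[symmetric]) (auto intro!: prod.cong)
    also have "(\<Prod>i\<in>{p..<p+q}. pairing (concat_forms p Phi Psi i) (w i)) = ?G (\<lambda>i. w (i + p))"
      by (rule prod.reindex_bij_witness[of _ "\<lambda>i. i + p" "\<lambda>i. i - p"])
         (auto simp: concat_forms_def)
    also have "(\<Prod>i<p. pairing (concat_forms p Phi Psi i) (w i)) = ?F w"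
      by (intro prod.cong) (auto simp: concat_forms_def)
    finally show ?thesis .
  qed
  have F: "?F v = ?F w" if "\<And>i. i < p \<Longrightarrow> v i = w i" for v w
    using that by (intro prod.cong) auto
  have eq: "(\<Sum>\<pi>\<in>{\<pi>. \<pi> permutes {..<p+q}}. of_int (sign \<pi>) * ?F (\<lambda>i. u (\<pi> i))
      * ?G (\<lambda>i. u (\<pi> (i + p)))) = wedgeF (concat_forms p Phi Psi) (p + q) u"
    unfolding wedgeF_def[of "concat_forms p Phi Psi"]
    by (rule sum.cong[OF refl]) (simp only: split mult.assoc)
  show ?thesis
    unfolding eq[symmetric] unfolding wedgeF_def[of Phi] wedgeF_def[of Psi]
    using alternating_product[where F = ?F and F' = ?G and u = u, OF F] .
qed

section \<open>Expansion in dual bases\<close>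

lemma bij_betw_jth:
  assumes "finite J" "card J = p"
  shows "bij_betw (jth J) {..<p} J"
  unfolding jth_def using assms
  by (intro bij_betw_nth) (simp_all add: atLeast0LessThan)

text \<open>An injection amounts to its image \<open>J\<close> together with the order in which it
  visits \<open>J\<close>; the permutation records that order relative to the increasing enumeration
  \<open>jth J\<close>.\<close>

lemma bij_betw_injections_subsets:
  fixes n p :: nat
  defines "E \<equiv> {f \<in> {..<p} \<rightarrow>\<^sub>E {..<n}. inj_on f {..<p}}"
  shows "bij_betw (\<lambda>(J, \<sigma>). restrict (\<lambda>i. jth J (\<sigma> i)) {..<p})
    ({J. J \<subseteq> {..<n} \<and> card J = p} \<times> {\<sigma>. \<sigma> permutes {..<p}}) E"
proof -
  let ?D = "{J. J \<subseteq> {..<n} \<and> card J = p} \<times> {\<sigma>. \<sigma> permutes {..<p::nat}}"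
  let ?h = "\<lambda>(J, \<sigma>). restrict (\<lambda>i. jth J (\<sigma> i)) {..<p}"
  have bij: "bij_betw (\<lambda>i. jth J (\<sigma> i)) {..<p} J" if "(J, \<sigma>) \<in> ?D" for J \<sigma>
  proof -
    have J: "finite J" "card J = p" and \<sigma>: "\<sigma> permutes {..<p}"
      using that finite_subset by auto
    from bij_betw_trans[OF permutes_imp_bij[OF \<sigma>] bij_betw_jth[OF J]] show ?thesis
      by (simp add: o_def)
  qed
  show ?thesis
  proof (rule bij_betw_imageI)
    show "inj_on ?h ?D"
    proof (rule inj_onI, clarify)
      fix J \<sigma> J' \<sigma>'
      assume J: "J \<subseteq> {..<n}" "p = card J" and J': "J' \<subseteq> {..<n}" "card J' = card J"
        and \<sigma>: "\<sigma> permutes {..<card J}" "\<sigma>' permutes {..<card J}"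
        and eq: "(\<lambda>i\<in>{..<card J}. jth J (\<sigma> i)) = (\<lambda>i\<in>{..<card J}. jth J' (\<sigma>' i))"
      have eq': "jth J (\<sigma> i) = jth J' (\<sigma>' i)" if "i < p" for i
        using fun_cong[OF eq, of i] that J by simp
      have "J = (\<lambda>i. jth J (\<sigma> i)) ` {..<p}"
        using bij[of J \<sigma>] J \<sigma> by (auto simp: bij_betw_def)
      also have "\<dots> = (\<lambda>i. jth J' (\<sigma>' i)) ` {..<p}"
        using eq' by (intro image_cong) auto
      also have "\<dots> = J'"
        using bij[of J' \<sigma>'] J J' \<sigma> by (auto simp: bij_betw_def)
      finally have JJ: "J = J'" .
      have "\<sigma> i = \<sigma>' i" for i
      proof (cases "i < p")
        case True
        have "inj_on (jth J) {..<p}"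
          using bij_betw_jth[of J p] J finite_subset by (auto simp: bij_betw_def)
        moreover have "\<sigma> i \<in> {..<p}" "\<sigma>' i \<in> {..<p}"
          using True J \<sigma> permutes_in_image[of _ "{..<p}" i] by auto
        ultimately show ?thesis
          using eq'[OF True] JJ by (simp add: inj_on_eq_iff)
      next
        case False
        then show ?thesis using J \<sigma> by (simp add: permutes_not_in)
      qed
      then show "J = J' \<and> \<sigma> = \<sigma>'" using JJ by auto
    qed
    show "?h ` ?D = E"
    proof (intro equalityI subsetI)
      fix f assume "f \<in> ?h ` ?D"
      then obtain J \<sigma> where J: "(J, \<sigma>) \<in> ?D" and f: "f = restrict (\<lambda>i. jth J (\<sigma> i)) {..<p}"
        by auto
      have "f \<in> {..<p} \<rightarrow>\<^sub>E {..<n}"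
        unfolding f using bij[OF J] J by (auto simp: bij_betw_def)
      moreover have "inj_on f {..<p}"
        unfolding f using bij[OF J] by (simp add: bij_betw_def)
      ultimately show "f \<in> E" unfolding E_def by simp
    next
      fix f assume "f \<in> E"
      then have f: "f \<in> {..<p} \<rightarrow>\<^sub>E {..<n}" "inj_on f {..<p}"
        unfolding E_def by auto
      define J where "J = f ` {..<p}"
      have J: "J \<subseteq> {..<n}" "card J = p" "finite J"
        using f card_image[OF f(2)] by (auto simp: J_def)
      \<comment> \<open>\<open>\<sigma> i\<close> is the position of \<open>f i\<close> in the
        increasing enumeration of \<open>J\<close>; indices from \<open>p\<close> on must be fixed
        for \<open>\<sigma>\<close> to permute the initial segment.\<close>
      define \<sigma> where "\<sigma> i = (if i < p then inv_into {..<p} (jth J) (f i) else i)" for i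
      have jb: "bij_betw (jth J) {..<p} J"
        using bij_betw_jth J by simp
      have fb: "bij_betw f {..<p} J"
        using f by (simp add: J_def bij_betw_def)
      have "bij_betw (inv_into {..<p} (jth J) \<circ> f) {..<p} {..<p}"
        using bij_betw_trans[OF fb bij_betw_inv_into[OF jb]] .
      moreover have "bij_betw (inv_into {..<p} (jth J) \<circ> f) {..<p} {..<p}
          = bij_betw \<sigma> {..<p} {..<p}"
        by (rule bij_betw_cong) (simp add: \<sigma>_def)
      ultimately have \<sigma>: "\<sigma> permutes {..<p}"
        by (intro bij_imp_permutes) (auto simp: \<sigma>_def)
      have "jth J (\<sigma> i) = f i" if "i < p" for i
        using that bij_betw_inv_into_right[OF jb, of "f i"] by (simp add: \<sigma>_def J_def)
      then have "f = ?h (J, \<sigma>)"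
        using f(1) by (auto simp: fun_eq_iff PiE_def extensional_def)
      moreover have "(J, \<sigma>) \<in> ?D" using J \<sigma> by simp
      ultimately show "f \<in> ?h ` ?D" by (rule image_eqI)
    qed
  qed
qed

text \<open>This is the Cauchy-Binet formula for the factorisation of the matrix of pairings through
  the bases \<open>v\<close> and \<open>d\<close>. Expanding every entry gives a sum over index
  functions; those with a repeated value produce a repeated slot, and the injections are grouped by
  their image.\<close>

lemma wedgeF_expand_dual_bases:
  assumes dual: "\<And>phi x. pairing phi x = (\<Sum>j<n. pairing phi (v j) * pairing (d j) x)"
  shows "wedgeF Phi p u = (\<Sum>J\<in>{J. J \<subseteq> {..<n} \<and> card J = p}.
    wedgeF (\<lambda>k. d (jth J k)) p u * wedgeF Phi p (\<lambda>k. v (jth J k)))"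
proof -
  let ?PE = "{..<p} \<rightarrow>\<^sub>E {..<n}" and ?P = "{\<pi>. \<pi> permutes {..<p}}"
    and ?JJ = "{J. J \<subseteq> {..<n} \<and> card J = p}"
  let ?E = "{f \<in> ?PE. inj_on f {..<p}}"
  let ?a = "\<lambda>f. \<Prod>i<p. pairing (Phi i) (v (f i))"
  have "wedgeF Phi p u = (\<Sum>\<pi>\<in>?P. of_int (sign \<pi>) *
      (\<Sum>f\<in>?PE. \<Prod>i<p. pairing (Phi i) (v (f i)) * pairing (d (f i)) (u (\<pi> i))))"
    unfolding wedgeF_def by (subst dual, subst prod_sum_PiE) simp_all
  also have "\<dots> = (\<Sum>f\<in>?PE. ?a f * wedgeF (\<lambda>i. d (f i)) p u)"
    unfolding wedgeF_def sum_distrib_left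
    by (subst sum.swap) (simp add: prod.distrib mult_ac)
  also have "\<dots> = (\<Sum>f\<in>?E. ?a f * wedgeF (\<lambda>i. d (f i)) p u)"
  proof (rule sum.mono_neutral_right)
    show "\<forall>f\<in>?PE - ?E. ?a f * wedgeF (\<lambda>i. d (f i)) p u = 0"
    proof
      fix f assume "f \<in> ?PE - ?E"
      then obtain i j where "i < p" "j < p" "i \<noteq> j" "f i = f j"
        by (auto simp: inj_on_def)
      then have "wedgeF (\<lambda>i. d (f i)) p u = 0"
        by (intro wedgeF_repeat[of i p j]) auto
      then show "?a f * wedgeF (\<lambda>i. d (f i)) p u = 0" by simp
    qed
  qed (auto intro: finite_PiE)
  also have "\<dots> = (\<Sum>(J, \<sigma>)\<in>?JJ \<times> ?P.
      ?a (\<lambda>i. jth J (\<sigma> i)) * wedgeF (\<lambda>i. d (jth J (\<sigma> i))) p u)"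
    unfolding sum.reindex_bij_betw[OF bij_betw_injections_subsets, symmetric]
    by (intro sum.cong refl) (auto intro!: arg_cong2[where f = "(*)"] wedgeF_cong)
  also have "\<dots> = (\<Sum>J\<in>?JJ. \<Sum>\<sigma>\<in>?P.
      ?a (\<lambda>i. jth J (\<sigma> i)) * wedgeF (\<lambda>i. d (jth J (\<sigma> i))) p u)"
    by (simp add: sum.cartesian_product)
  also have "\<dots> = (\<Sum>J\<in>?JJ. wedgeF (\<lambda>k. d (jth J k)) p u * wedgeF Phi p (\<lambda>k. v (jth J k)))"
  proof (rule sum.cong[OF refl])
    fix J
    have "(\<Sum>\<sigma>\<in>?P. ?a (\<lambda>i. jth J (\<sigma> i)) * wedgeF (\<lambda>i. d (jth J (\<sigma> i))) p u)
      = (\<Sum>\<sigma>\<in>?P. wedgeF (\<lambda>k. d (jth J k)) p u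
          * (of_int (sign \<sigma>) * ?a (\<lambda>i. jth J (\<sigma> i))))"
      by (intro sum.cong refl)
        (simp add: wedgeF_permute_forms[of _ p "\<lambda>k. d (jth J k)" u])
    also have "\<dots> = wedgeF (\<lambda>k. d (jth J k)) p u * wedgeF Phi p (\<lambda>k. v (jth J k))"
      unfolding wedgeF_def[of Phi] by (rule sum_distrib_left[symmetric])
    finally show "(\<Sum>\<sigma>\<in>?P. ?a (\<lambda>i. jth J (\<sigma> i)) * wedgeF (\<lambda>i. d (jth J (\<sigma> i))) p u)
      = wedgeF (\<lambda>k. d (jth J k)) p u * wedgeF Phi p (\<lambda>k. v (jth J k))" .
  qed
  finally show ?thesis .
qed

section \<open>Eigenbases\<close>

text \<open>\<open>act T\<close> evaluates at the functional \<open>phi\<close> composed with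
  \<open>T\<close>, so a linear function \<open>lin y\<close> sees the composite at
  \<open>y\<close>, which is \<open>phi\<close> at \<open>T y\<close>.\<close>

lemma act_lin:
  assumes "Vector_Spaces.linear (*s) (*s) T"
  shows "act T (lin y) = lin (T y)"
proof
  fix phi
  have "T y = T (\<Sum>k\<in>UNIV. y $ k *s axis k 1)"
    by (simp add: basis_expansion)
  also have "\<dots> = (\<Sum>k\<in>UNIV. y $ k *s T (axis k 1))"
    by (simp add: vec.linear_sum[OF assms] vec.linear_scale[OF assms])
  finally have "lin (T y) phi = (\<Sum>k\<in>UNIV. y $ k * pairing phi (T (axis k 1)))"
    by (simp add: lin_def pairing_sum_right pairing_scale_right)
  then show "act T (lin y) phi = lin (T y) phi"
    by (simp add: act_def lin_def pairing_def[of "\<chi> i. pairing phi (T (axis i 1))"] mult.commute)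
qed

text \<open>Continuity along lines extends an identity of polynomials across the hyperplane where a
  divisor vanishes.\<close>

lemma polys_continuous_line:
  assumes "f \<in> polys"
  shows "isCont (\<lambda>t. f (phi + t *s d)) t"
  using assms
proof induction
  case (linear v)
  show ?case
    by (simp add: lin_def pairing_add_left pairing_scale_left)
qed auto

text \<open>The dual of the complement of V^g, described without the inner product;
  \<open>dualsub_orth_fixsp\<close> identifies the two descriptions.\<close>

definition ann :: "('g \<Rightarrow> complex^'n^'n) \<Rightarrow> 'g \<Rightarrow> (complex^'n) set" where
  "ann \<rho> g = {phi. \<forall>w\<in>fixsp \<rho> g. pairing phi w = 0}"

lemma subspace_ann: "vec.subspace (ann \<rho> g)"
  by (auto simp: vec.subspace_def ann_def pairing_add_left pairing_scale_left)

lemma subspace_fixsp: "vec.subspace (fixsp \<rho> g)"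
  by (auto simp: vec.subspace_def fixsp_def matrix_vector_right_distrib vec.scale)

section \<open>Coordinates in an eigenbasis of a single group element\<close>

locale eigenbasis =
  fixes \<rho> :: "'g \<Rightarrow> complex^'n^'n" and b :: "'g \<Rightarrow> nat \<Rightarrow> complex^'n" and g :: 'g
  assumes eig: "\<And>i. i < CARD('n) \<Longrightarrow> \<exists>\<epsilon>. \<rho> g *v b g i = \<epsilon> *s b g i"
    and indep: "\<And>c i. (\<Sum>i<CARD('n). c i *s b g i) = 0 \<Longrightarrow> i < CARD('n) \<Longrightarrow> c i = 0"
    and spans: "\<And>v. \<exists>c. v = (\<Sum>i<CARD('n). c i *s b g i)"
begin

lemma b_nonzero:
  assumes "i < CARD('n)" shows "b g i \<noteq> 0"
proof
  assume "b g i = 0"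
  then have "(\<Sum>j<CARD('n). (if j = i then 1 else 0) *s b g j) = 0"
    by (intro sum.neutral) auto
  from indep[OF this assms] show False by simp
qed

lemma b_coeff_unique:
  assumes "(\<Sum>j<CARD('n). c j *s b g j) = (\<Sum>j<CARD('n). c' j *s b g j)" "i < CARD('n)"
  shows "c i = c' i"
proof -
  have "(\<Sum>j<CARD('n). (c j - c' j) *s b g j) = 0"
    using assms(1) by (simp add: vec.scale_left_diff_distrib sum_subtractf)
  from indep[OF this assms(2)] show ?thesis by simp
qed

lemma rho_b:
  assumes "i < CARD('n)"
  shows "\<rho> g *v b g i = eigval \<rho> b g i *s b g i"
proof -
  obtain e where e: "\<rho> g *v b g i = e *s b g i" using eig[OF assms] by auto
  have "eigval \<rho> b g i = e"
    unfolding eigval_def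
    by (rule the_equality) (use e b_nonzero[OF assms] in auto)
  then show ?thesis using e by simp
qed

lemma pairing_eq_on_b:
  assumes "\<And>j. j < CARD('n) \<Longrightarrow> pairing phi (b g j) = pairing psi (b g j)"
  shows "phi = psi"
proof (rule pairing_eqI)
  fix v
  obtain c where "v = (\<Sum>i<CARD('n). c i *s b g i)" using spans by blast
  then show "pairing phi v = pairing psi v"
    using assms by (simp add: pairing_sum_right pairing_scale_right)
qed

text \<open>This justifies the definite description in \<open>dualb\<close>. Existence comes from a
  choice of coordinates in the eigenbasis, uniqueness from the fact that the eigenbasis
  spans.\<close>

lemma dualb_b:
  assumes "i < CARD('n)" "j < CARD('n)"
  shows "pairing (dualb b g i) (b g j) = (if i = j then 1 else 0)"
proof -
  obtain co where co: "\<And>v. v = (\<Sum>i<CARD('n). co v i *s b g i)" using spans by metis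
  \<comment> \<open>The functional sending each standard basis vector to its \<open>i\<close>-th
    coefficient in the eigenbasis.\<close>
  let ?phi = "\<chi> k. co (axis k 1) i"
  have "pairing ?phi (b g j) = (if i = j then 1 else 0)" if j: "j < CARD('n)" for j
  proof -
    have "(\<Sum>m<CARD('n). (\<Sum>k\<in>UNIV. b g j $ k * co (axis k 1) m) *s b g m)
      = (\<Sum>m<CARD('n). \<Sum>k\<in>UNIV. b g j $ k *s (co (axis k 1) m *s b g m))"
      by (simp add: vec.scale_sum_left)
    also have "\<dots> = (\<Sum>k\<in>UNIV. \<Sum>m<CARD('n). b g j $ k *s (co (axis k 1) m *s b g m))"
      by (rule sum.swap)
    also have "\<dots> = (\<Sum>k\<in>UNIV. b g j $ k *s axis k 1)"
      by (simp only: vec.scale_sum_right[symmetric] co[symmetric])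
    also have "\<dots> = b g j" by (simp add: basis_expansion)
    also have "\<dots> = (\<Sum>m<CARD('n). (if m = j then 1 else 0) *s b g m)"
      using j by (simp add: if_distrib[where f = "\<lambda>c. c *s _"] cong: if_cong)
    finally have "(\<Sum>k\<in>UNIV. b g j $ k * co (axis k 1) i) = (if i = j then 1 else 0)"
      using assms(1) by (rule b_coeff_unique)
    then show ?thesis by (simp add: pairing_def mult.commute)
  qed
  then have "dualb b g i = ?phi"
    unfolding dualb_def by (intro the_equality) (auto intro!: pairing_eq_on_b)
  then show ?thesis
    using \<open>\<And>j. j < CARD('n) \<Longrightarrow> pairing ?phi (b g j) = _\<close> assms by simp
qed

lemma b_expansion: "x = (\<Sum>j<CARD('n). pairing (dualb b g j) x *s b g j)"
proof -
  obtain c where c: "x = (\<Sum>i<CARD('n). c i *s b g i)" using spans by blast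
  have "pairing (dualb b g j) x = c j" if "j < CARD('n)" for j
    using that by (simp add: c pairing_sum_right pairing_scale_right dualb_b
        if_distrib[where f = "\<lambda>c. _ * c"] cong: if_cong)
  then show ?thesis using c by simp
qed

text \<open>The resolution of the identity required by
  \<open>wedgeF_expand_dual_bases\<close>.\<close>

lemma pairing_expansion:
  "pairing phi x = (\<Sum>j<CARD('n). pairing phi (b g j) * pairing (dualb b g j) x)"
  by (subst b_expansion) (simp add: pairing_sum_right pairing_scale_right mult.commute)

lemma dualb_rho:
  assumes "i < CARD('n)"
  shows "pairing (dualb b g i) (\<rho> g *v x) = eigval \<rho> b g i * pairing (dualb b g i) x"
proof -
  have "\<rho> g *v x = (\<Sum>j<CARD('n). pairing (dualb b g j) x *s (\<rho> g *v b g j))"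
    by (subst b_expansion[of x]) (simp add: vec.sum vec.scale)
  also have "\<dots> = (\<Sum>j<CARD('n). (pairing (dualb b g j) x * eigval \<rho> b g j) *s b g j)"
    by (simp add: rho_b)
  finally show ?thesis
    using assms by (simp add: pairing_sum_right pairing_scale_right dualb_b
        if_distrib[where f = "\<lambda>c. _ * c"] cong: if_cong)
qed

lemma fixsp_iff:
  "x \<in> fixsp \<rho> g \<longleftrightarrow> (\<forall>i<CARD('n). eigval \<rho> b g i \<noteq> 1 \<longrightarrow> pairing (dualb b g i) x = 0)"
proof
  assume "x \<in> fixsp \<rho> g"
  then show "\<forall>i<CARD('n). eigval \<rho> b g i \<noteq> 1 \<longrightarrow> pairing (dualb b g i) x = 0"
    using dualb_rho[of _ x] by (auto simp: fixsp_def)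
next
  assume *: "\<forall>i<CARD('n). eigval \<rho> b g i \<noteq> 1 \<longrightarrow> pairing (dualb b g i) x = 0"
  have "\<rho> g *v x = (\<Sum>j<CARD('n). pairing (dualb b g j) (\<rho> g *v x) *s b g j)"
    by (rule b_expansion)
  also have "\<dots> = (\<Sum>j<CARD('n). pairing (dualb b g j) x *s b g j)"
    using * by (intro sum.cong refl) (auto simp: dualb_rho)
  also have "\<dots> = x" by (rule b_expansion[symmetric])
  finally show "x \<in> fixsp \<rho> g" by (simp add: fixsp_def)
qed

lemma b_in_fixsp: "i < CARD('n) \<Longrightarrow> eigval \<rho> b g i = 1 \<Longrightarrow> b g i \<in> fixsp \<rho> g"
  by (simp add: fixsp_def rho_b)

lemma inj_on_b: "inj_on (b g) {..<CARD('n)}"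
proof (rule inj_onI)
  fix i j assume "i \<in> {..<CARD('n)}" "j \<in> {..<CARD('n)}" "b g i = b g j"
  then show "i = j" using dualb_b[of i j] dualb_b[of i i] by (auto split: if_splits)
qed

lemma independent_b:
  assumes "I \<subseteq> {..<CARD('n)}"
  shows "vec.independent (b g ` I)"
proof
  assume "vec.dependent (b g ` I)"
  then obtain i where i: "i \<in> I" "b g i \<in> vec.span (b g ` I - {b g i})"
    unfolding vec.dependent_def by auto
  have "vec.subspace {x. pairing (dualb b g i) x = 0}"
    by (auto simp: vec.subspace_def pairing_add_right pairing_scale_right)
  moreover have "b g ` I - {b g i} \<subseteq> {x. pairing (dualb b g i) x = 0}"
    using i assms by (auto simp: dualb_b subset_iff)
  ultimately have "pairing (dualb b g i) (b g i) = 0"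
    using vec.span_minimal i(2) by blast
  then show False using i(1) assms by (auto simp: dualb_b subset_iff)
qed

text \<open>The eigenvectors with eigenvalue 1 form a basis of V^g, so the codimension counts the
  others.\<close>

lemma codim_fix_eq: "codim_fix \<rho> g = card {i. i < CARD('n) \<and> eigval \<rho> b g i \<noteq> 1}"
proof -
  let ?I = "{i. i < CARD('n) \<and> eigval \<rho> b g i = 1}"
  have "vec.dim (fixsp \<rho> g) = card ?I"
  proof (rule vec.dim_unique)
    show "b g ` ?I \<subseteq> fixsp \<rho> g" using b_in_fixsp by auto
    show "fixsp \<rho> g \<subseteq> vec.span (b g ` ?I)"
    proof
      fix x assume x: "x \<in> fixsp \<rho> g"
      have "(\<Sum>j<CARD('n). pairing (dualb b g j) x *s b g j) \<in> vec.span (b g ` ?I)"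
      proof (intro vec.span_sum)
        fix j assume "j \<in> {..<CARD('n)}"
        then show "pairing (dualb b g j) x *s b g j \<in> vec.span (b g ` ?I)"
          using x by (cases "eigval \<rho> b g j = 1")
            (auto simp: fixsp_iff vec.span_zero intro!: vec.span_scale[OF vec.span_base])
      qed
      then show "x \<in> vec.span (b g ` ?I)" using b_expansion[of x] by simp
    qed
    show "vec.independent (b g ` ?I)" by (rule independent_b) auto
    show "card (b g ` ?I) = card ?I"
      by (intro card_image inj_on_subset[OF inj_on_b]) auto
  qed
  moreover have "card ({..<CARD('n)} - ?I) = CARD('n) - card ?I"
    by (subst card_Diff_subset) auto
  moreover have "{..<CARD('n)} - ?I = {i. i < CARD('n) \<and> eigval \<rho> b g i \<noteq> 1}" by auto
  ultimately show ?thesis by (simp add: codim_fix_def)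
qed

text \<open>A functional vanishing on V^g has no component along the dual vectors of eigenvalue 1.
  The bound limits how many independent functionals a wedge can take from the annihilator.\<close>

lemma dim_ann_le: "vec.dim (ann \<rho> g) \<le> codim_fix \<rho> g"
proof -
  let ?I = "{i. i < CARD('n) \<and> eigval \<rho> b g i \<noteq> 1}"
  have "ann \<rho> g \<subseteq> vec.span (dualb b g ` ?I)"
  proof
    fix phi assume phi: "phi \<in> ann \<rho> g"
    have "phi = (\<Sum>j<CARD('n). pairing phi (b g j) *s dualb b g j)"
      by (rule pairing_eqI, subst pairing_expansion) (simp add: pairing_sum_left pairing_scale_left)
    also have "\<dots> \<in> vec.span (dualb b g ` ?I)"
    proof (intro vec.span_sum)
      fix j assume "j \<in> {..<CARD('n)}"
      then show "pairing phi (b g j) *s dualb b g j \<in> vec.span (dualb b g ` ?I)"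
        using phi by (cases "eigval \<rho> b g j = 1")
          (auto simp: ann_def b_in_fixsp vec.span_zero intro!: vec.span_scale[OF vec.span_base])
    qed
    finally show "phi \<in> vec.span (dualb b g ` ?I)" .
  qed
  then have "vec.dim (ann \<rho> g) \<le> card (dualb b g ` ?I)"
    by (rule vec.dim_le_card) simp
  also have "\<dots> \<le> card ?I" by (rule card_image_le) simp
  finally show ?thesis by (simp add: codim_fix_eq)
qed

lemma linear_diagmap: "Vector_Spaces.linear (*s) (*s) (diagmap \<rho> b g P)"
  unfolding Vector_Spaces.linear_iff diagmap_def
  by (auto intro!: vec.vector_space_axioms
      simp: pairing_add_right pairing_scale_right vec.scale_left_distrib distrib_left sum.distrib
        vec.scale_sum_right mult_ac)

lemma srefl_diff:
  assumes "i < CARD('n)"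
  shows "x - srefl \<rho> b g i x = ((1 - eigval \<rho> b g i) * pairing (dualb b g i) x) *s b g i"
proof -
  have "x - srefl \<rho> b g i x = (\<Sum>j<CARD('n). (if j = i then 1 - eigval \<rho> b g j else 0)
      *s (pairing (dualb b g j) x *s b g j))"
    unfolding srefl_def diagmap_def
    by (subst b_expansion[of x], subst sum_subtractf[symmetric])
       (intro sum.cong refl, auto simp: algebra_simps vec.scale_left_diff_distrib)
  also have "\<dots> = (\<Sum>j<CARD('n). if j = i
      then (1 - eigval \<rho> b g j) *s (pairing (dualb b g j) x *s b g j) else 0)"
    by (intro sum.cong) auto
  also have "\<dots> = (1 - eigval \<rho> b g i) *s (pairing (dualb b g i) x *s b g i)"
    using assms by simp
  finally show ?thesis by simp
qed

text \<open>Both cases produce the coordinate of \<open>x\<close> along \<open>b g i\<close>: the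
  derivative is taken in the direction of the dual vector, and in the quotient case
  \<open>srefl_diff\<close> makes numerator and divisor proportional with this ratio.\<close>

lemma qpartial_lin:
  assumes "i < CARD('n)"
  shows "qpartial \<rho> b g i (lin x) = (\<lambda>phi. pairing (dualb b g i) x)"
proof (cases "eigval \<rho> b g i = 1")
  case True
  have "((\<lambda>t. lin x (phi + t *s dualb b g i)) has_field_derivative pairing (dualb b g i) x) (at 0)"
    for phi
    unfolding lin_def pairing_add_left pairing_scale_left
    by (auto intro!: derivative_eq_intros)
  then show ?thesis
    using True by (auto simp: qpartial_def intro: DERIV_imp_deriv)
next
  case False
  let ?e = "eigval \<rho> b g i" and ?c = "pairing (dualb b g i) x"
  have diff: "lin y phi - act (srefl \<rho> b g i) (lin y) phi
      = (1 - ?e) * pairing (dualb b g i) y * lin (b g i) phi" for y phi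
  proof -
    have "lin y phi - act (srefl \<rho> b g i) (lin y) phi = pairing phi (y - srefl \<rho> b g i y)"
      using act_lin[OF linear_diagmap] by (simp add: srefl_def lin_def pairing_diff_right)
    then show ?thesis by (simp add: srefl_diff[OF assms] pairing_scale_right lin_def)
  qed
  have "(THE q. q \<in> polys \<and> (\<forall>phi. q phi *
               (lin (b g i) phi - act (srefl \<rho> b g i) (lin (b g i)) phi)
             = lin x phi - act (srefl \<rho> b g i) (lin x) phi)) = (\<lambda>phi. ?c)"
  proof (rule the_equality)
    show "(\<lambda>phi. ?c) \<in> polys \<and> (\<forall>phi. ?c *
               (lin (b g i) phi - act (srefl \<rho> b g i) (lin (b g i)) phi)
             = lin x phi - act (srefl \<rho> b g i) (lin x) phi)"
      by (auto simp: polys.const diff dualb_b[OF assms assms])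
  next
    fix q assume "q \<in> polys \<and> (\<forall>phi. q phi *
               (lin (b g i) phi - act (srefl \<rho> b g i) (lin (b g i)) phi)
             = lin x phi - act (srefl \<rho> b g i) (lin x) phi)"
    then have q: "q \<in> polys"
      and q': "\<And>phi. q phi * ((1 - ?e) * lin (b g i) phi) = (1 - ?e) * ?c * lin (b g i) phi"
      by (auto simp: diff dualb_b[OF assms assms])
    have qc: "q phi = ?c" if "lin (b g i) phi \<noteq> 0" for phi
      using that False q'[of phi] by simp
    show "q = (\<lambda>phi. ?c)"
    proof
      fix phi
      show "q phi = ?c"
      proof (cases "lin (b g i) phi = 0")
        case True
        \<comment> \<open>On the zero set of the divisor the defining equation says nothing about
          \<open>q\<close>. Moving \<open>phi\<close> off this hyperplane along the dual vector
          gives the value for \<open>t \<noteq> 0\<close>, and continuity carries it back to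
          \<open>t = 0\<close>.\<close>
        let ?f = "\<lambda>t. q (phi + t *s dualb b g i)"
        have "?f t = ?c" if "t \<noteq> 0" for t
        proof (rule qc)
          have "lin (b g i) (phi + t *s dualb b g i) = t"
            using True by (simp add: lin_def pairing_add_left pairing_scale_left
                dualb_b[OF assms assms])
          then show "lin (b g i) (phi + t *s dualb b g i) \<noteq> 0" using that by simp
        qed
        then have "?f \<midarrow>0\<rightarrow> ?c"
          by (intro tendsto_eventually) (auto simp: eventually_at_filter)
        moreover have "?f \<midarrow>0\<rightarrow> ?f 0"
          using polys_continuous_line[OF q, where phi = phi and d = "dualb b g i" and t = 0] by (simp add: isCont_def)
        ultimately show ?thesis
          using LIM_unique by fastforce
      next
        case False
        then show ?thesis by (rule qc)
      qed
    qed
  qed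
  then show ?thesis using False by (simp add: qpartial_def)
qed

text \<open>The quantum derivatives of linear functions are constants, and the prefix maps fix
  constants; no eigenvalue survives in the formula.\<close>

lemma Upsilon_lin:
  assumes "g \<in> carrier G"
  shows "Upsilon G \<rho> b p \<alpha> (\<lambda>i. lin (w i)) g phi
    = (\<Sum>J\<in>{J. J \<subseteq> {..<CARD('n)} \<and> card J = p}.
        (\<Prod>k<p. pairing (dualb b g (jth J k)) (w k)) * \<alpha> g (\<lambda>k. b g (jth J k)) phi)"
proof -
  have "jth J k < CARD('n)" if "J \<subseteq> {..<CARD('n)}" "card J = p" "k < p" for J k
    using bij_betw_jth[of J p] that finite_subset by (auto simp: bij_betw_def)
  then show ?thesis
    using assms by (auto simp: Upsilon_def qpartial_lin act_def intro!: sum.cong prod.cong)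
qed

text \<open>Antisymmetrising the pairings gives determinants of dual vectors, and Cauchy-Binet
  reassembles the form. So \<open>PhiStar\<close> undoes \<open>Upsilon\<close> on such components.
  The point \<open>phi\<close> is fixed to make the coefficients numbers, which also permits
  evaluation at a point moved by the group.\<close>

lemma Upsilon_alternating:
  assumes g: "g \<in> carrier G"
    and \<alpha>: "\<And>w. \<alpha> g w phi = (\<Sum>m<M. c m * wedgeF (Phi m) p w)"
  shows "(\<Sum>\<sigma>\<in>{\<sigma>. \<sigma> permutes {..<p}}. of_int (sign \<sigma>)
      * Upsilon G \<rho> b p \<alpha> (\<lambda>i. lin (w (\<sigma> i))) g phi) = \<alpha> g w phi"
proof -
  let ?J = "{J. J \<subseteq> {..<CARD('n)} \<and> card J = p}"
  have "(\<Sum>\<sigma>\<in>{\<sigma>. \<sigma> permutes {..<p}}. of_int (sign \<sigma>)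
      * Upsilon G \<rho> b p \<alpha> (\<lambda>i. lin (w (\<sigma> i))) g phi)
    = (\<Sum>J\<in>?J. wedgeF (\<lambda>k. dualb b g (jth J k)) p w * \<alpha> g (\<lambda>k. b g (jth J k)) phi)"
    unfolding Upsilon_lin[OF g] sum_distrib_left wedgeF_def sum_distrib_right
    by (subst sum.swap) (simp add: mult_ac)
  also have "\<dots> = (\<Sum>m<M. c m * (\<Sum>J\<in>?J. wedgeF (\<lambda>k. dualb b g (jth J k)) p w
      * wedgeF (Phi m) p (\<lambda>k. b g (jth J k))))"
    unfolding \<alpha> sum_distrib_left by (subst sum.swap) (simp add: mult_ac)
  also have "\<dots> = \<alpha> g w phi"
    unfolding \<alpha> by (simp only: wedgeF_expand_dual_bases[OF pairing_expansion, symmetric])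
  finally show ?thesis .
qed

end

section \<open>Fixed spaces and their annihilators\<close>

lemma act_polys:
  assumes "Vector_Spaces.linear (*s) (*s) T" "f \<in> polys"
  shows "act T f \<in> polys"
  using assms(2)
proof induction
  case (linear v)
  then show ?case by (simp add: act_lin[OF assms(1)] polys.linear)
qed (auto simp: act_def intro: polys.intros)

lemma linear_matrix: "Vector_Spaces.linear (*s) (*s) (\<lambda>v. (A :: complex^'n^'n) *v v)"
  by (rule matrix_vector_mul_linear_gen)

lemma gact_polys: "f \<in> polys \<Longrightarrow> gact \<rho> g f \<in> polys"
  unfolding gact_def by (rule act_polys[OF linear_matrix])

lemma gact_lin: "gact \<rho> g (lin y) = lin (\<rho> g *v y)"
  unfolding gact_def by (rule act_lin[OF linear_matrix])

lemma idealI_0: "(\<lambda>phi. 0) \<in> idealI Hm W"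
  unfolding idealI_def by (intro CollectI exI[of _ 0]) auto

lemma idealI_lin: "w \<in> W \<Longrightarrow> lin w \<in> idealI Hm W"
  unfolding idealI_def
  by (intro CollectI exI[of _ 1] exI[of _ "\<lambda>_ _. 1"] exI[of _ "\<lambda>_. w"]) (auto intro: polys.const)

lemma sum_lessThan_add: "(\<Sum>k<m + n. f k) = (\<Sum>k<m. f k) + (\<Sum>k<n. f (m + k))" for m n :: nat
  by (induction n) (simp_all add: add.assoc)

lemma idealI_add:
  assumes "r \<in> idealI Hm W" "s \<in> idealI Hm W"
  shows "(\<lambda>phi. r phi + s phi) \<in> idealI Hm W"
proof -
  from assms(1) obtain K rs ws where r: "\<forall>k<(K::nat). rs k \<in> polys \<and> ws k \<in> W"
    "r = (\<lambda>phi. \<Sum>k<K. rs k phi * lin (ws k) phi)" unfolding idealI_def by blast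
  from assms(2) obtain L ss vs where s: "\<forall>k<(L::nat). ss k \<in> polys \<and> vs k \<in> W"
    "s = (\<lambda>phi. \<Sum>k<L. ss k phi * lin (vs k) phi)" unfolding idealI_def by blast
  show ?thesis
    unfolding idealI_def
  proof (intro CollectI exI conjI)
    let ?r = "\<lambda>k. if k < K then rs k else ss (k - K)" and ?w = "\<lambda>k. if k < K then ws k else vs (k - K)"
    show "\<forall>k<K + L. ?r k \<in> polys \<and> ?w k \<in> W" using r(1) s(1) by auto
    show "(\<lambda>phi. r phi + s phi) = (\<lambda>phi. \<Sum>k<K + L. ?r k phi * lin (?w k) phi)"
      by (simp add: sum_lessThan_add r(2) s(2))
  qed
qed

lemma idealI_mult:
  assumes "r \<in> idealI Hm W" "f \<in> polys"
  shows "(\<lambda>phi. f phi * r phi) \<in> idealI Hm W"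
proof -
  from assms(1) obtain K rs ws where r: "\<forall>k<(K::nat). rs k \<in> polys \<and> ws k \<in> W"
    "r = (\<lambda>phi. \<Sum>k<K. rs k phi * lin (ws k) phi)" unfolding idealI_def by blast
  have "\<forall>k<K. (\<lambda>phi. f phi * rs k phi) \<in> polys \<and> ws k \<in> W"
    using r(1) assms(2) by (auto intro: polys.mult)
  then show ?thesis
    unfolding idealI_def
    by (intro CollectI exI[of _ K] exI[of _ "\<lambda>k phi. f phi * rs k phi"] exI[of _ ws])
       (auto simp: r(2) sum_distrib_left mult_ac)
qed

lemma idealI_mono: "W \<subseteq> W' \<Longrightarrow> idealI Hm W \<subseteq> idealI Hm W'"
  unfolding idealI_def by blast

lemma Zg_0: "(\<lambda>u phi. 0) \<in> Zg \<rho> Hm R g N"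
  unfolding Zg_def by (intro CollectI exI[of _ 0]) auto

lemma Zg_add:
  assumes "A \<in> Zg \<rho> Hm R g N" "B \<in> Zg \<rho> Hm R g N"
  shows "(\<lambda>u phi. A u phi + B u phi) \<in> Zg \<rho> Hm R g N"
proof -
  let ?P = "\<lambda>f Phi. codim_fix \<rho> g \<le> N \<and> f \<in> R
         \<and> (\<forall>i<N - codim_fix \<rho> g. Phi i \<in> dualsub Hm (fixsp \<rho> g))
         \<and> (\<forall>i. N - codim_fix \<rho> g \<le> i \<and> i < N \<longrightarrow> Phi i \<in> dualsub Hm (orth Hm (fixsp \<rho> g)))"
  from assms(1) obtain K f Phi where A: "\<forall>m<(K::nat). ?P (f m) (Phi m)"
    "A = (\<lambda>u phi. \<Sum>m<K. f m phi * wedgeF (Phi m) N u)" unfolding Zg_def by blast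
  from assms(2) obtain L f' Phi' where B: "\<forall>m<(L::nat). ?P (f' m) (Phi' m)"
    "B = (\<lambda>u phi. \<Sum>m<L. f' m phi * wedgeF (Phi' m) N u)" unfolding Zg_def by blast
  show ?thesis
    unfolding Zg_def
  proof (rule CollectI, rule exI[of _ "K + L"],
      rule exI[of _ "\<lambda>k. if k < K then f k else f' (k - K)"],
      rule exI[of _ "\<lambda>k. if k < K then Phi k else Phi' (k - K)"], rule conjI)
    show "\<forall>m<K + L. ?P (if m < K then f m else f' (m - K)) (if m < K then Phi m else Phi' (m - K))"
    proof (intro allI impI)
      fix m assume "m < K + L"
      then show "?P (if m < K then f m else f' (m - K)) (if m < K then Phi m else Phi' (m - K))"
        using A(1)[rule_format, of m] B(1)[rule_format, of "m - K"] by (cases "m < K") simp_all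
    qed
  qed (simp add: sum_lessThan_add A(2) B(2))
qed

lemma Zg_sum:
  assumes "\<And>i. i \<in> I \<Longrightarrow> A i \<in> Zg \<rho> Hm R g N"
  shows "(\<lambda>u phi. \<Sum>i\<in>I. A i u phi) \<in> Zg \<rho> Hm R g N"
  using assms
  by (induction I rule: infinite_finite_induct) (simp_all add: Zg_0 Zg_add)

text \<open>Serves to move the functionals indexed by \<open>S\<close> into the last slots, where
  \<open>Zg\<close> expects those that annihilate V^g.\<close>

lemma permutes_onto_tail:
  fixes N :: nat
  assumes "S \<subseteq> {..<N}"
  obtains \<sigma> where "\<sigma> permutes {..<N}" "\<And>i. N - card S \<le> i \<Longrightarrow> i < N \<Longrightarrow> \<sigma> i \<in> S"
proof -
  let ?c = "card S"
  have fS: "finite S" using assms finite_subset by blast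
  have c: "?c \<le> N" using card_mono[OF _ assms] by simp
  obtain h1 where h1: "bij_betw h1 {N - ?c..<N} S"
    using finite_same_card_bij[of "{N - ?c..<N}" S] fS c by auto
  have "card ({..<N} - S) = N - ?c"
    using assms fS by (simp add: card_Diff_subset)
  then obtain h2 where h2: "bij_betw h2 {..<N - ?c} ({..<N} - S)"
    using finite_same_card_bij[of "{..<N - ?c}" "{..<N} - S"] by auto
  define \<sigma> where "\<sigma> i = (if i < N - ?c then h2 i else if i < N then h1 i else i)" for i
  have "bij_betw \<sigma> {N - ?c..<N} S"
    using h1 by (subst bij_betw_cong[of _ _ h1]) (auto simp: \<sigma>_def)
  moreover have "bij_betw \<sigma> {..<N - ?c} ({..<N} - S)"
    using h2 by (subst bij_betw_cong[of _ _ h2]) (auto simp: \<sigma>_def)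
  ultimately have "bij_betw \<sigma> ({N - ?c..<N} \<union> {..<N - ?c}) (S \<union> ({..<N} - S))"
    by (rule bij_betw_combine) auto
  moreover have "{N - ?c..<N} \<union> {..<N - ?c} = {..<N}" by auto
  moreover have "S \<union> ({..<N} - S) = {..<N}" using assms by auto
  ultimately have "\<sigma> permutes {..<N}"
    by (intro bij_imp_permutes) (auto simp: \<sigma>_def)
  moreover have "\<sigma> i \<in> S" if "N - ?c \<le> i" "i < N" for i
    using \<open>bij_betw \<sigma> {N - ?c..<N} S\<close> that by (auto simp: bij_betw_def)
  ultimately show ?thesis using that by blast
qed

section \<open>Orthogonal complements for the Hermitian form\<close>

lemma herm_ip_diff: "herm_ip Hm w (x - y) = herm_ip Hm w x - herm_ip Hm w y"
  by (simp add: herm_ip_def right_diff_distrib sum_subtractf)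

lemma herm_ip_scale: "herm_ip Hm w (c *s x) = c * herm_ip Hm w x"
  by (simp add: herm_ip_def sum_distrib_left mult_ac)

lemma herm_ip_add: "herm_ip Hm w (x + y) = herm_ip Hm w x + herm_ip Hm w y"
  by (simp add: herm_ip_def distrib_left sum.distrib)

lemma herm_ip_zero: "herm_ip Hm w 0 = 0"
  by (simp add: herm_ip_def)

lemma subspace_orth: "vec.subspace (orth Hm W)"
  by (simp add: vec.subspace_def orth_def herm_ip_add herm_ip_scale herm_ip_zero)

section \<open>Unitary representations: moved vectors, complements and annihilators\<close>

locale unitary_rep =
  fixes G :: "'g monoid"
    and \<rho> :: "'g \<Rightarrow> complex^'n^'n"
    and Hm :: "complex^'n^'n"
    and b :: "'g \<Rightarrow> nat \<Rightarrow> complex^'n"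
  assumes grp: "group G" and fin: "finite (carrier G)"
    and rep_mult: "\<forall>x\<in>carrier G. \<forall>y\<in>carrier G. \<rho> (x \<otimes>\<^bsub>G\<^esub> y) = \<rho> x ** \<rho> y"
    and rep_one: "\<rho> \<one>\<^bsub>G\<^esub> = mat 1"
    and herm: "\<forall>i j. Hm $ i $ j = cnj (Hm $ j $ i)"
    and posdef: "\<forall>v. v \<noteq> 0 \<longrightarrow> 0 < Re (herm_ip Hm v v)"
    and invariant: "\<forall>g\<in>carrier G. \<forall>v w. herm_ip Hm (\<rho> g *v v) (\<rho> g *v w) = herm_ip Hm v w"
    and eb: "eigenbases G \<rho> b"
begin

lemma eigenbasis_at:
  assumes "g \<in> carrier G" shows "eigenbasis \<rho> b g"
proof -
  have *: "(\<forall>i<CARD('n). \<exists>\<epsilon>. \<rho> g *v b g i = \<epsilon> *s b g i)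
    \<and> (\<forall>c. (\<Sum>i<CARD('n). c i *s b g i) = 0 \<longrightarrow> (\<forall>i<CARD('n). c i = 0))
    \<and> (\<forall>v. \<exists>c. v = (\<Sum>i<CARD('n). c i *s b g i))"
    using eb assms unfolding eigenbases_def by blast
  show ?thesis by (rule eigenbasis.intro) (use * in simp_all)
qed

lemma inv_closed: "g \<in> carrier G \<Longrightarrow> inv\<^bsub>G\<^esub> g \<in> carrier G"
  by (rule group.inv_closed[OF grp])

lemma rho_inv_rho: "g \<in> carrier G \<Longrightarrow> \<rho> (inv\<^bsub>G\<^esub> g) *v (\<rho> g *v x) = x"
  using rep_mult[rule_format, symmetric, of "inv\<^bsub>G\<^esub> g" g] rep_one group.l_inv[OF grp, of g] inv_closed[of g]
  by (simp add: matrix_vector_mul_assoc matrix_vector_mul_lid)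

lemma rho_rho_inv: "g \<in> carrier G \<Longrightarrow> \<rho> g *v (\<rho> (inv\<^bsub>G\<^esub> g) *v x) = x"
  using rep_mult[rule_format, symmetric, of g "inv\<^bsub>G\<^esub> g"] rep_one group.r_inv[OF grp, of g] inv_closed[of g]
  by (simp add: matrix_vector_mul_assoc matrix_vector_mul_lid)

lemma rho_mult: "g \<in> carrier G \<Longrightarrow> h \<in> carrier G \<Longrightarrow> \<rho> (g \<otimes>\<^bsub>G\<^esub> h) *v x = \<rho> g *v (\<rho> h *v x)"
  using rep_mult by (simp add: matrix_vector_mul_assoc)

lemma fixsp_inv: "g \<in> carrier G \<Longrightarrow> fixsp \<rho> (inv\<^bsub>G\<^esub> g) = fixsp \<rho> g"
  unfolding fixsp_def by (metis rho_inv_rho rho_rho_inv)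

lemma herm_ip_commute: "herm_ip Hm v w = cnj (herm_ip Hm w v)"
  unfolding herm_ip_def
  by (simp, subst sum.swap, intro sum.cong refl) (metis herm complex_cnj_cnj mult.commute mult.assoc)

lemma herm_ip_self: "herm_ip Hm v v = 0 \<Longrightarrow> v = 0"
  using posdef[rule_format, of v] by force

text \<open>For \<open>w\<close> fixed by \<open>g\<close>, invariance gives <w, g x> = <g w, g x> =
  <w, x>.\<close>

lemma rho_minus_in_orth:
  assumes "g \<in> carrier G" shows "\<rho> g *v x - x \<in> orth Hm (fixsp \<rho> g)"
proof -
  have "herm_ip Hm w (\<rho> g *v x) = herm_ip Hm w x" if "w \<in> fixsp \<rho> g" for w
    using invariant[rule_format, OF assms, of w x] that by (simp add: fixsp_def)
  then show ?thesis by (auto simp: orth_def herm_ip_diff)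
qed

lemma orth_inter: "x \<in> W \<Longrightarrow> x \<in> orth Hm W \<Longrightarrow> x = 0"
  unfolding orth_def using herm_ip_self by blast

lemma subset_orth_orth: "W \<subseteq> orth Hm (orth Hm W)"
  unfolding orth_def by (auto, subst herm_ip_commute, simp)

text \<open>The eigenvectors of eigenvalue 1 lie in V^g and the others in its complement. If
  \<open>x\<close> is orthogonal to V^g, its component along the former is both in V^g and
  orthogonal to it, hence zero.\<close>

lemma orth_fixsp_iff:
  assumes g: "g \<in> carrier G"
  shows "x \<in> orth Hm (fixsp \<rho> g)
    \<longleftrightarrow> (\<forall>j<CARD('n). eigval \<rho> b g j = 1 \<longrightarrow> pairing (dualb b g j) x = 0)"
proof -
  interpret eigenbasis \<rho> b g using eigenbasis_at[OF g] .
  let ?I = "{j. j < CARD('n) \<and> eigval \<rho> b g j = 1}" and ?K = "{j. j < CARD('n) \<and> eigval \<rho> b g j \<noteq> 1}"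
  let ?x1 = "\<Sum>j\<in>?I. pairing (dualb b g j) x *s b g j"
    and ?x2 = "\<Sum>j\<in>?K. pairing (dualb b g j) x *s b g j"
  have "{..<CARD('n)} = ?I \<union> ?K" by auto
  then have x: "x = ?x1 + ?x2"
    using b_expansion[of x] by (subst sum.union_disjoint[symmetric]) auto
  have x1: "?x1 \<in> fixsp \<rho> g"
    by (intro vec.subspace_sum[OF subspace_fixsp])
      (auto intro!: vec.subspace_scale[OF subspace_fixsp] b_in_fixsp)
  \<comment> \<open>Such a \<open>b g j\<close> is the moved vector g b - b divided by \<epsilon> -
    1, which is nonzero.\<close>
  have "b g j \<in> orth Hm (fixsp \<rho> g)" if "j \<in> ?K" for j
  proof -
    have "\<rho> g *v b g j - b g j = (eigval \<rho> b g j - 1) *s b g j"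
      using that by (simp add: rho_b vec.scale_left_diff_distrib)
    then have "(1 / (eigval \<rho> b g j - 1)) *s (\<rho> g *v b g j - b g j)
        = (1 / (eigval \<rho> b g j - 1)) *s ((eigval \<rho> b g j - 1) *s b g j)"
      by (rule arg_cong)
    also have "\<dots> = b g j" unfolding vec.scale_scale using that by simp
    finally show ?thesis
      using vec.subspace_scale[OF subspace_orth rho_minus_in_orth[OF g]] by metis
  qed
  then have x2: "?x2 \<in> orth Hm (fixsp \<rho> g)"
    by (intro vec.subspace_sum[OF subspace_orth])
      (auto intro!: vec.subspace_scale[OF subspace_orth])
  show ?thesis
  proof
    assume "x \<in> orth Hm (fixsp \<rho> g)"
    then have "x - ?x2 \<in> orth Hm (fixsp \<rho> g)"
      by (rule vec.subspace_diff[OF subspace_orth _ x2])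
    moreover have "x - ?x2 = ?x1" by (subst x) (rule add_diff_cancel_right')
    ultimately have "?x1 = 0" by (intro orth_inter[OF x1]) (simp only:)
    have "pairing (dualb b g j) x = 0" if "j \<in> ?I" for j
    proof -
      have "pairing (dualb b g j) ?x1 = (\<Sum>i\<in>?I. if i = j then pairing (dualb b g i) x else 0)"
        using that unfolding pairing_sum_right
        by (intro sum.cong) (auto simp: pairing_scale_right dualb_b)
      then show ?thesis using that \<open>?x1 = 0\<close> by simp
    qed
    then show "\<forall>j<CARD('n). eigval \<rho> b g j = 1 \<longrightarrow> pairing (dualb b g j) x = 0" by simp
  next
    assume "\<forall>j<CARD('n). eigval \<rho> b g j = 1 \<longrightarrow> pairing (dualb b g j) x = 0"
    then have "?x1 = 0" by (intro sum.neutral) auto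
    then have "x = ?x2" by (subst x) (simp only: add_0)
    with x2 show "x \<in> orth Hm (fixsp \<rho> g)" by (simp only:)
  qed
qed

text \<open>For \<open>x\<close> in the double complement put y = g x - x, which lies in the
  complement. Then <y, x> = 0, and <y, g x> = <g^-1 y, x> = 0 because g^-1 y stays in the
  complement. Hence <y, y> = 0 and \<open>x\<close> is fixed.\<close>

lemma orth_orth_fixsp:
  assumes g: "g \<in> carrier G"
  shows "orth Hm (orth Hm (fixsp \<rho> g)) = fixsp \<rho> g"
proof
  show "orth Hm (orth Hm (fixsp \<rho> g)) \<subseteq> fixsp \<rho> g"
  proof
    fix x assume x: "x \<in> orth Hm (orth Hm (fixsp \<rho> g))"
    have "herm_ip Hm (\<rho> g *v x - x) (\<rho> g *v x - x) = 0"
    proof -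
      have o: "herm_ip Hm y x = 0" if "y \<in> orth Hm (fixsp \<rho> g)" for y
        using x that by (simp add: orth_def[of Hm "orth Hm (fixsp \<rho> g)"])
      have i: "\<rho> (inv\<^bsub>G\<^esub> g) *v y - y \<in> orth Hm (fixsp \<rho> g)" for y
        using rho_minus_in_orth[OF inv_closed[OF g]] fixsp_inv[OF g] by simp
      have r: "\<rho> g *v x - x \<in> orth Hm (fixsp \<rho> g)" by (rule rho_minus_in_orth[OF g])
      let ?y = "\<rho> g *v x - x"
      have "herm_ip Hm ?y (\<rho> g *v x) = herm_ip Hm (\<rho> (inv\<^bsub>G\<^esub> g) *v ?y) (\<rho> (inv\<^bsub>G\<^esub> g) *v (\<rho> g *v x))"
        using invariant inv_closed[OF g] by simp
      also have "\<dots> = herm_ip Hm (\<rho> (inv\<^bsub>G\<^esub> g) *v ?y) x"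
        by (simp add: rho_inv_rho[OF g])
      also have "\<dots> = 0"
      proof (rule o)
        have "?y + (\<rho> (inv\<^bsub>G\<^esub> g) *v ?y - ?y) \<in> orth Hm (fixsp \<rho> g)"
          by (rule vec.subspace_add[OF subspace_orth r i])
        then show "\<rho> (inv\<^bsub>G\<^esub> g) *v ?y \<in> orth Hm (fixsp \<rho> g)" by simp
      qed
      finally show ?thesis using o[OF r] by (simp add: herm_ip_diff)
    qed
    then have "\<rho> g *v x - x = 0" by (rule herm_ip_self)
    then show "x \<in> fixsp \<rho> g" by (simp add: fixsp_def)
  qed
qed (rule subset_orth_orth)

lemma dualsub_orth_fixsp:
  assumes g: "g \<in> carrier G"
  shows "dualsub Hm (orth Hm (fixsp \<rho> g)) = ann \<rho> g"
  unfolding dualsub_def ann_def orth_orth_fixsp[OF g] ..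

text \<open>\<open>psi\<close> is the part of \<open>phi\<close> along the dual vectors of
  eigenvalue 1: it agrees with \<open>phi\<close> on V^g and vanishes on the complement.\<close>

lemma dualsub_ann_decomposition:
  assumes g: "g \<in> carrier G"
  obtains psi where "psi \<in> dualsub Hm (fixsp \<rho> g)" "psi - phi \<in> ann \<rho> g"
proof -
  interpret eigenbasis \<rho> b g using eigenbasis_at[OF g] .
  let ?I = "{j. j < CARD('n) \<and> eigval \<rho> b g j = 1}"
  let ?psi = "\<Sum>j\<in>?I. pairing phi (b g j) *s dualb b g j"
  have "?psi \<in> dualsub Hm (fixsp \<rho> g)"
    unfolding dualsub_def
    by (auto simp: pairing_sum_left pairing_scale_left orth_fixsp_iff[OF g] intro!: sum.neutral)
  moreover have "pairing phi w = pairing ?psi w" if "w \<in> fixsp \<rho> g" for w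
  proof -
    have "pairing phi w = (\<Sum>j<CARD('n). pairing phi (b g j) * pairing (dualb b g j) w)"
      by (rule pairing_expansion)
    also have "\<dots> = (\<Sum>j\<in>?I. pairing phi (b g j) * pairing (dualb b g j) w)"
      using that by (intro sum.mono_neutral_right) (auto simp: fixsp_iff)
    finally show ?thesis by (simp add: pairing_sum_left pairing_scale_left)
  qed
  then have "?psi - phi \<in> ann \<rho> g"
    by (simp add: ann_def pairing_diff_left)
  ultimately show ?thesis using that by blast
qed

lemma dim_ann_le: "g \<in> carrier G \<Longrightarrow> vec.dim (ann \<rho> g) \<le> codim_fix \<rho> g"
  using eigenbasis.dim_ann_le[OF eigenbasis_at] .

text \<open>The slots outside \<open>S\<close> may be arbitrary: their components in \<open>ann \<rho> g\<close> are killed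
  by the top form filling the slots in \<open>S\<close>.\<close>
lemma Zg_term:
  assumes g: "g \<in> carrier G" and f: "f \<in> R" and R: "\<And>c. (\<lambda>phi. c * f phi) \<in> R"
    and S: "S \<subseteq> {..<N}" "card S = codim_fix \<rho> g" "\<And>s. s \<in> S \<Longrightarrow> Phi s \<in> ann \<rho> g"
  shows "(\<lambda>u phi. f phi * wedgeF Phi N u) \<in> Zg \<rho> Hm R g N"
proof -
  let ?c = "codim_fix \<rho> g"
  obtain \<sigma> where \<sigma>: "\<sigma> permutes {..<N}" and \<sigma>S: "\<And>i. N - ?c \<le> i \<Longrightarrow> i < N \<Longrightarrow> \<sigma> i \<in> S"
    using permutes_onto_tail[OF S(1)] S(2) by metis
  have c: "?c \<le> N" using card_mono[OF _ S(1)] S(2) by simp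
  have "\<exists>psi. psi \<in> dualsub Hm (fixsp \<rho> g) \<and> psi - Phi (\<sigma> i) \<in> ann \<rho> g" for i
    using dualsub_ann_decomposition[OF g] by metis
  then obtain psi where psi: "\<And>i. psi i \<in> dualsub Hm (fixsp \<rho> g)" "\<And>i. psi i - Phi (\<sigma> i) \<in> ann \<rho> g"
    by metis
  \<comment> \<open>The functionals from \<open>S\<close> stay in the tail; every other slot is
    replaced by its component in the dual of V^g.\<close>
  let ?Psi = "\<lambda>i. if i < N - ?c then psi i else Phi (\<sigma> i)"
  have eq: "of_int (sign \<sigma>) * wedgeF ?Psi N u = wedgeF Phi N u" for u
  proof -
    have "wedgeF ?Psi N u = wedgeF (\<lambda>i. Phi (\<sigma> i)) N u"
    proof (rule wedgeF_absorb)
      show "{N - ?c..<N} \<subseteq> {..<N}" by auto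
      show "Phi (\<sigma> s) \<in> ann \<rho> g" if "s \<in> {N - ?c..<N}" for s
        using that \<sigma>S S(3) by auto
      show "vec.dim (ann \<rho> g) \<le> card {N - ?c..<N}"
        using dim_ann_le[OF g] c by simp
      show "?Psi i - Phi (\<sigma> i) \<in> ann \<rho> g" for i
        using psi(2) vec.subspace_0[OF subspace_ann] by auto
    qed auto
    then show ?thesis
      unfolding wedgeF_permute_forms[OF \<sigma>] by (simp add: mult.assoc[symmetric] flip: of_int_mult)
  qed
  show ?thesis
    unfolding Zg_def
  proof (intro CollectI exI conjI)
    \<comment> \<open>A single summand suffices. The sign of the reordering goes into the polynomial
      coefficient, hence the closure of \<open>R\<close> under scalars.\<close>
    show "\<forall>m<1::nat. ?c \<le> N \<and> (\<lambda>phi. of_int (sign \<sigma>) * f phi) \<in> R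
      \<and> (\<forall>i<N - ?c. ?Psi i \<in> dualsub Hm (fixsp \<rho> g))
      \<and> (\<forall>i. N - ?c \<le> i \<and> i < N \<longrightarrow> ?Psi i \<in> dualsub Hm (orth Hm (fixsp \<rho> g)))"
      using c R psi(1) S(3) \<sigma>S by (auto simp: dualsub_orth_fixsp[OF g])
    show "(\<lambda>u phi. f phi * wedgeF Phi N u)
      = (\<lambda>u phi. \<Sum>m<1::nat. (of_int (sign \<sigma>) * f phi) * wedgeF ?Psi N u)"
      by (simp add: eq[symmetric] mult_ac)
  qed
qed

text \<open>If the wedge is nonzero then \<open>ann \<rho> g \<inter> ann \<rho> h = 0\<close>, i.e. the moved spaces of \<open>g\<close> and
  \<open>h\<close> meet trivially; for \<open>x\<close> fixed by \<open>g h\<close> the vector \<open>h x - x = g\<inverse> x - x\<close>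
  lies in both of them.\<close>
lemma wedge_nonzero:
  assumes g: "g \<in> carrier G" and h: "h \<in> carrier G"
    and S: "S \<subseteq> {..<N}" "card S = codim_fix \<rho> g" "\<And>s. s \<in> S \<Longrightarrow> Phi s \<in> ann \<rho> g"
    and T: "T \<subseteq> {..<N}" "card T = codim_fix \<rho> h" "\<And>s. s \<in> T \<Longrightarrow> Phi s \<in> ann \<rho> h"
    and ST: "S \<inter> T = {}" and nz: "wedgeF Phi N u \<noteq> 0"
  shows "fixsp \<rho> (g \<otimes>\<^bsub>G\<^esub> h) \<subseteq> fixsp \<rho> g \<inter> fixsp \<rho> h"
    and "codim_fix \<rho> (g \<otimes>\<^bsub>G\<^esub> h) = card (S \<union> T)"
proof -
  let ?k = "g \<otimes>\<^bsub>G\<^esub> h"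
  have k: "?k \<in> carrier G" using g h grp by (simp add: group.is_monoid monoid.m_closed)
  have cardST: "card (S \<union> T) = codim_fix \<rho> g + codim_fix \<rho> h"
    using S(2) T(2) ST finite_subset[OF S(1)] finite_subset[OF T(1)] by (simp add: card_Un_disjoint)
  have sub: "S \<union> T \<subseteq> {..<N}" using S T by auto
  \<comment> \<open>All \<open>card (S \<union> T)\<close> slots lie in the sum of the two
    annihilators. A nonzero determinant makes this sum at least that large, which leaves dimension 0
    for the intersection.\<close>
  let ?W = "{x + y |x y. x \<in> ann \<rho> g \<and> y \<in> ann \<rho> h}"
  have "Phi s \<in> ?W" if "s \<in> S \<union> T" for s
  proof -
    have "0 \<in> ann \<rho> g" "0 \<in> ann \<rho> h"
      by (rule vec.subspace_0[OF subspace_ann])+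
    then show ?thesis using that S(3)[of s] T(3)[of s] by (cases "s \<in> S") force+
  qed
  then have "card (S \<union> T) \<le> vec.dim ?W"
    using wedgeF_eq_0_of_dim[OF sub, of Phi ?W u] nz by force
  moreover have "vec.dim ?W + vec.dim (ann \<rho> g \<inter> ann \<rho> h) = vec.dim (ann \<rho> g) + vec.dim (ann \<rho> h)"
    by (rule vec.dim_sums_Int[OF subspace_ann subspace_ann])
  ultimately have "vec.dim (ann \<rho> g \<inter> ann \<rho> h) = 0"
    using cardST dim_ann_le[OF g] dim_ann_le[OF h] by linarith
  then have int: "ann \<rho> g \<inter> ann \<rho> h \<subseteq> {0}" by simp
  show sub_fix: "fixsp \<rho> ?k \<subseteq> fixsp \<rho> g \<inter> fixsp \<rho> h"
  proof
    fix x assume "x \<in> fixsp \<rho> ?k"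
    then have gh: "\<rho> g *v (\<rho> h *v x) = x" using rho_mult[OF g h] by (simp add: fixsp_def)
    let ?y = "\<rho> h *v x - x"
    have hx: "\<rho> h *v x = \<rho> (inv\<^bsub>G\<^esub> g) *v x" using rho_inv_rho[OF g, of "\<rho> h *v x"] gh by simp
    have yh: "?y \<in> orth Hm (fixsp \<rho> h)" by (rule rho_minus_in_orth[OF h])
    have yg: "?y \<in> orth Hm (fixsp \<rho> g)"
      using rho_minus_in_orth[OF inv_closed[OF g], of x] fixsp_inv[OF g] hx by simp
    \<comment> \<open>The functional <y, -> transfers orthogonality to V^z into annihilation of V^z,
      so the moved vector y can be tested in the intersection of the annihilators.\<close>
    let ?phi = "\<chi> j. \<Sum>i\<in>UNIV. cnj (?y $ i) * Hm $ i $ j"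
    have phi: "pairing ?phi w = herm_ip Hm ?y w" for w
      unfolding pairing_def herm_ip_def by (simp add: sum_distrib_right, rule sum.swap)
    have "?phi \<in> ann \<rho> z" if "?y \<in> orth Hm (fixsp \<rho> z)" for z
      unfolding ann_def mem_Collect_eq
    proof
      fix w assume "w \<in> fixsp \<rho> z"
      then have "herm_ip Hm w ?y = 0" using that by (simp add: orth_def)
      then show "pairing ?phi w = 0" unfolding phi by (subst herm_ip_commute) simp
    qed
    from this[OF yg] this[OF yh] have "?phi \<in> ann \<rho> g" "?phi \<in> ann \<rho> h" .
    then have "?phi = 0" using int by blast
    then have "herm_ip Hm ?y ?y = 0" using phi[of ?y] by simp
    then have y: "?y = 0" by (rule herm_ip_self)
    then have "x \<in> fixsp \<rho> h" by (simp add: fixsp_def)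
    moreover from y gh have "x \<in> fixsp \<rho> g" by (simp add: fixsp_def)
    ultimately show "x \<in> fixsp \<rho> g \<inter> fixsp \<rho> h" by blast
  qed
  \<comment> \<open>The inclusion of fixed spaces puts every slot into the annihilator for the
    product, so the nonzero determinant now bounds its codimension from below.\<close>
  have "card (S \<union> T) \<le> vec.dim (ann \<rho> ?k)"
  proof (rule ccontr)
    assume "\<not> card (S \<union> T) \<le> vec.dim (ann \<rho> ?k)"
    moreover have "Phi s \<in> ann \<rho> ?k" if "s \<in> S \<union> T" for s
      using that S(3)[of s] T(3)[of s] sub_fix by (auto simp: ann_def)
    ultimately have "wedgeF Phi N u = 0"
      using wedgeF_eq_0_of_dim[OF sub, of Phi "ann \<rho> ?k" u] by simp
    then show False using nz by simp
  qed
  then have ge: "card (S \<union> T) \<le> codim_fix \<rho> ?k" using dim_ann_le[OF k] by simp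
  have "fixsp \<rho> g \<inter> fixsp \<rho> h \<subseteq> fixsp \<rho> ?k"
    using rho_mult[OF g h] by (auto simp: fixsp_def)
  then have keq: "fixsp \<rho> ?k = fixsp \<rho> g \<inter> fixsp \<rho> h" using sub_fix by (intro equalityI)
  \<comment> \<open>The opposite bound is subadditivity of codimension: the sum of the two fixed
    spaces has dimension at most n.\<close>
  let ?V = "{x + y |x y. x \<in> fixsp \<rho> g \<and> y \<in> fixsp \<rho> h}"
  have dim: "vec.dim A \<le> CARD('n)" for A :: "(complex^'n) set"
    using vec.dim_subset_UNIV[of A] by (simp add: vec.dimension_def card_cart_basis)
  have "vec.dim ?V + vec.dim (fixsp \<rho> g \<inter> fixsp \<rho> h) = vec.dim (fixsp \<rho> g) + vec.dim (fixsp \<rho> h)"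
    by (rule vec.dim_sums_Int[OF subspace_fixsp subspace_fixsp])
  moreover note dim[of ?V] dim[of "fixsp \<rho> g"] dim[of "fixsp \<rho> h"]
  ultimately have "codim_fix \<rho> ?k \<le> codim_fix \<rho> g + codim_fix \<rho> h"
    unfolding codim_fix_def keq by linarith
  then show "codim_fix \<rho> ?k = card (S \<union> T)" using ge cardST by simp
qed

text \<open>On generators the difference is \<open>lin\<close> of a moved vector, and products obey
  a twisted Leibniz rule: g(f f') - f f' = gf' (gf - f) + f (gf' - f').\<close>

lemma gact_minus_in_ideal:
  assumes g: "g \<in> carrier G" and "f \<in> polys"
  shows "(\<lambda>phi. gact \<rho> g f phi - f phi) \<in> idealI Hm (orth Hm (fixsp \<rho> g))"
  using assms(2)
proof induction
  case (const c)
  then show ?case by (simp add: gact_def act_def idealI_0)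
next
  case (linear v)
  have "(\<lambda>phi. gact \<rho> g (lin v) phi - lin v phi) = lin (\<rho> g *v v - v)"
    by (simp add: gact_lin fun_eq_iff) (simp add: lin_def pairing_diff_right)
  then show ?case by (simp add: idealI_lin rho_minus_in_orth[OF g])
next
  case (add f f')
  then show ?case using idealI_add[OF add.IH] by (simp add: gact_def act_def algebra_simps)
next
  case (mult f f')
  have "(\<lambda>phi. gact \<rho> g (\<lambda>phi. f phi * f' phi) phi - f phi * f' phi)
    = (\<lambda>phi. gact \<rho> g f' phi * (gact \<rho> g f phi - f phi) + f phi * (gact \<rho> g f' phi - f' phi))"
    by (simp add: gact_def act_def algebra_simps)
  then show ?case
    using idealI_add[OF idealI_mult[OF mult.IH(1) gact_polys[OF mult.hyps(2)]]
        idealI_mult[OF mult.IH(2) mult.hyps(1)]] by simp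
qed

end

section \<open>The cup product\<close>

text \<open>Bilinearity reduces to \<open>wedge_product\<close>, whose factorials cancel the
  normalisation. At a fixed \<open>phi\<close> the coefficients are numbers.\<close>

lemma wedgeK_wedgeF_sums:
  assumes A: "\<And>w. A w phi = (\<Sum>m<M. f m * wedgeF (Phi m) p w)"
    and B: "\<And>w. B w phi = (\<Sum>l<L. f' l * wedgeF (Psi l) q w)"
  shows "wedgeK p q A B u phi
    = (\<Sum>m<M. \<Sum>l<L. f m * f' l * wedgeF (concat_forms p (Phi m) (Psi l)) (p + q) u)"
proof -
  let ?P = "{\<pi>. \<pi> permutes {..<p+q}}"
  let ?t = "\<lambda>m l \<pi>. of_int (sign \<pi>) * wedgeF (Phi m) p (\<lambda>i. u (\<pi> i))
    * wedgeF (Psi l) q (\<lambda>i. u (\<pi> (i + p)))"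
  have "(\<Sum>\<pi>\<in>?P. of_int (sign \<pi>) * A (\<lambda>i. u (\<pi> i)) phi * B (\<lambda>i. u (\<pi> (i + p))) phi)
    = (\<Sum>\<pi>\<in>?P. \<Sum>m<M. \<Sum>l<L. f m * f' l * ?t m l \<pi>)"
  proof (rule sum.cong[OF refl])
    fix \<pi>
    show "of_int (sign \<pi>) * A (\<lambda>i. u (\<pi> i)) phi * B (\<lambda>i. u (\<pi> (i + p))) phi
      = (\<Sum>m<M. \<Sum>l<L. f m * f' l * ?t m l \<pi>)"
      unfolding A B mult_sum_product by (simp only: mult_ac)
  qed
  also have "\<dots> = (\<Sum>m<M. \<Sum>l<L. f m * f' l * (\<Sum>\<pi>\<in>?P. ?t m l \<pi>))"
    unfolding sum_distrib_left
    by (rule trans[OF sum.swap], rule sum.cong[OF refl], rule sum.swap)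
  also have "\<dots> = of_nat (fact p * fact q)
      * (\<Sum>m<M. \<Sum>l<L. f m * f' l * wedgeF (concat_forms p (Phi m) (Psi l)) (p + q) u)"
    unfolding wedge_product sum_distrib_left by (simp only: mult_ac)
  finally show ?thesis unfolding wedgeK_def by simp
qed

lemma idealI_scale: "r \<in> idealI Hm W \<Longrightarrow> (\<lambda>phi. c * r phi) \<in> idealI Hm W"
  using idealI_mult[OF _ polys.const] .

context unitary_rep
begin

text \<open>Records the last slots in the normal form of an element of \<open>Zg\<close>; the
  earlier slots stay free, since \<open>Zg_term\<close> projects them when a membership in
  \<open>Zg\<close> has to be proved.\<close>

definition top_slots :: "'g \<Rightarrow> nat \<Rightarrow> (nat \<Rightarrow> complex^'n) \<Rightarrow> bool" where
  "top_slots g p Phi \<longleftrightarrow> codim_fix \<rho> g \<le> p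
     \<and> (\<forall>i. p - codim_fix \<rho> g \<le> i \<and> i < p \<longrightarrow> Phi i \<in> ann \<rho> g)"

section \<open>Products of homogeneous components\<close>

lemma Zset_expansion:
  assumes "\<alpha> \<in> Zset G \<rho> Hm p" "g \<in> carrier G"
  obtains M f Phi where "\<And>m. m < M \<Longrightarrow> f m \<in> polys" "\<And>m. m < M \<Longrightarrow> top_slots g p (Phi m)"
    "\<And>u phi. \<alpha> g u phi = (\<Sum>m<(M::nat). f m phi * wedgeF (Phi m) p u)"
proof -
  have "\<alpha> g \<in> Zg \<rho> Hm polys g p" using assms by (simp add: Zset_def)
  then obtain M f Phi where "\<forall>m<(M::nat). codim_fix \<rho> g \<le> p \<and> f m \<in> polys
      \<and> (\<forall>i<p - codim_fix \<rho> g. Phi m i \<in> dualsub Hm (fixsp \<rho> g))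
      \<and> (\<forall>i. p - codim_fix \<rho> g \<le> i \<and> i < p \<longrightarrow> Phi m i \<in> dualsub Hm (orth Hm (fixsp \<rho> g)))"
    and "\<alpha> g = (\<lambda>u phi. \<Sum>m<M. f m phi * wedgeF (Phi m) p u)"
    unfolding Zg_def by blast
  then show ?thesis
    using that[of M f Phi] by (simp add: dualsub_orth_fixsp[OF assms(2)] top_slots_def)
qed

text \<open>Letting \<open>g\<close> act on a functional changes it by one that annihilates V^g, and
  the top slots of \<open>Phi\<close> absorb this change.\<close>

lemma wedgeF_twist:
  assumes g: "g \<in> carrier G" and Phi: "top_slots g p Phi"
  shows "wedgeF (concat_forms p Phi (\<lambda>i. Psi i v* \<rho> (inv\<^bsub>G\<^esub> g))) (p + q) u
    = wedgeF (concat_forms p Phi Psi) (p + q) u"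
proof (rule wedgeF_absorb)
  let ?S = "{p - codim_fix \<rho> g..<p}"
  show "?S \<subseteq> {..<p + q}" by auto
  show "concat_forms p Phi Psi s \<in> ann \<rho> g" if "s \<in> ?S" for s
    using that Phi by (simp add: concat_forms_def top_slots_def)
  show "vec.dim (ann \<rho> g) \<le> card ?S"
    using dim_ann_le[OF g] Phi by (simp add: top_slots_def)
  have "\<rho> (inv\<^bsub>G\<^esub> g) *v w = w" if "w \<in> fixsp \<rho> g" for w
    using that fixsp_inv[OF g] by (auto simp: fixsp_def)
  then have "psi v* \<rho> (inv\<^bsub>G\<^esub> g) - psi \<in> ann \<rho> g" for psi
    by (simp add: ann_def pairing_diff_left pairing_matrix[symmetric])
  then show "concat_forms p Phi (\<lambda>i. Psi i v* \<rho> (inv\<^bsub>G\<^esub> g)) i - concat_forms p Phi Psi i \<in> ann \<rho> g" for i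
    using vec.subspace_0[OF subspace_ann, of \<rho> g] by (simp add: concat_forms_def)
qed (auto simp: concat_forms_def)

text \<open>A vanishing determinant gives the zero cochain. Otherwise \<open>wedge_nonzero\<close>
  shows that the top slots of both factors together are top slots for the product, and supplies the
  inclusion of fixed spaces under which \<open>f \<in> R\<close> is known.\<close>

lemma product_in_Zg:
  assumes g: "g \<in> carrier G" and h: "h \<in> carrier G"
    and Phi: "top_slots g p Phi" and Psi: "top_slots h q Psi"
    and f: "fixsp \<rho> (g \<otimes>\<^bsub>G\<^esub> h) \<subseteq> fixsp \<rho> g \<Longrightarrow> f \<in> R"
    and R: "\<And>r c. r \<in> R \<Longrightarrow> (\<lambda>phi. c * r phi) \<in> R"
  shows "(\<lambda>u phi. f phi * wedgeF (concat_forms p Phi Psi) (p + q) u)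
    \<in> Zg \<rho> Hm R (g \<otimes>\<^bsub>G\<^esub> h) (p + q)"
proof (cases "\<exists>u. wedgeF (concat_forms p Phi Psi) (p + q) u \<noteq> 0")
  case False
  then show ?thesis using Zg_0 by simp
next
  case True
  then obtain u where u: "wedgeF (concat_forms p Phi Psi) (p + q) u \<noteq> 0" by blast
  let ?X = "concat_forms p Phi Psi"
  define S where "S = {p - codim_fix \<rho> g..<p}"
  define T where "T = {p + q - codim_fix \<rho> h..<p + q}"
  have c: "codim_fix \<rho> g \<le> p" "codim_fix \<rho> h \<le> q" using Phi Psi by (auto simp: top_slots_def)
  have S: "S \<subseteq> {..<p + q}" "card S = codim_fix \<rho> g" and T: "T \<subseteq> {..<p + q}" "card T = codim_fix \<rho> h"
    and ST: "S \<inter> T = {}"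
    using c by (auto simp: S_def T_def)
  have XS: "?X s \<in> ann \<rho> g" if "s \<in> S" for s
    using that Phi by (simp add: concat_forms_def top_slots_def S_def)
  have XT: "?X s \<in> ann \<rho> h" if "s \<in> T" for s
  proof -
    have "\<not> s < p" "q - codim_fix \<rho> h \<le> s - p \<and> s - p < q" using that c by (auto simp: T_def)
    then show ?thesis using Psi by (simp add: concat_forms_def top_slots_def)
  qed
  note nz = wedge_nonzero[OF g h S XS T XT ST u]
  show ?thesis
  proof (rule Zg_term)
    show "g \<otimes>\<^bsub>G\<^esub> h \<in> carrier G" using g h grp by (simp add: group.is_monoid monoid.m_closed)
    show "f \<in> R" using f nz(1) by blast
    then show "(\<lambda>phi. c * f phi) \<in> R" for c by (rule R)
    show "S \<union> T \<subseteq> {..<p + q}" using S T by blast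
    show "card (S \<union> T) = codim_fix \<rho> (g \<otimes>\<^bsub>G\<^esub> h)" using nz(2) by simp
    show "?X s \<in> ann \<rho> (g \<otimes>\<^bsub>G\<^esub> h)" if "s \<in> S \<union> T" for s
      using that XS[of s] XT[of s] nz(1) by (auto simp: ann_def)
  qed
qed

text \<open>In the first product \<open>g\<close> acts on coefficients and forms, in the second on
  coefficients only. Both have the same expansion by \<open>wedgeF_twist\<close>.\<close>

lemma wedgeK_gactK:
  assumes g: "g \<in> carrier G"
    and A: "\<And>w phi. A w phi = (\<Sum>m<M. f m phi * wedgeF (Phi m) p w)"
    and Phi: "\<And>m. m < M \<Longrightarrow> top_slots g p (Phi m)"
    and B: "\<And>w phi. B w phi = (\<Sum>l<L. f' l phi * wedgeF (Psi l) q w)"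
  shows "wedgeK p q A (gactK G \<rho> g B) u phi = (\<Sum>m<M. \<Sum>l<L.
      f m phi * gact \<rho> g (f' l) phi * wedgeF (concat_forms p (Phi m) (Psi l)) (p + q) u)"
    and "wedgeK p q A (\<lambda>w. gact \<rho> g (B w)) u phi = (\<Sum>m<M. \<Sum>l<L.
      f m phi * gact \<rho> g (f' l) phi * wedgeF (concat_forms p (Phi m) (Psi l)) (p + q) u)"
proof -
  have "wedgeF (Psi l) q (\<lambda>i. \<rho> (inv\<^bsub>G\<^esub> g) *v w i)
      = wedgeF (\<lambda>i. Psi l i v* \<rho> (inv\<^bsub>G\<^esub> g)) q w" for l w
    by (simp add: wedgeF_def pairing_matrix)
  then have "wedgeK p q A (gactK G \<rho> g B) u phi = (\<Sum>m<M. \<Sum>l<L. f m phi * gact \<rho> g (f' l) phi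
      * wedgeF (concat_forms p (Phi m) (\<lambda>i. Psi l i v* \<rho> (inv\<^bsub>G\<^esub> g))) (p + q) u)"
    by (intro wedgeK_wedgeF_sums) (simp_all add: A B gactK_def gact_def act_def)
  then show "wedgeK p q A (gactK G \<rho> g B) u phi = (\<Sum>m<M. \<Sum>l<L.
      f m phi * gact \<rho> g (f' l) phi * wedgeF (concat_forms p (Phi m) (Psi l)) (p + q) u)"
    by (simp add: wedgeF_twist[OF g Phi])
  show "wedgeK p q A (\<lambda>w. gact \<rho> g (B w)) u phi = (\<Sum>m<M. \<Sum>l<L.
      f m phi * gact \<rho> g (f' l) phi * wedgeF (concat_forms p (Phi m) (Psi l)) (p + q) u)"
    by (intro wedgeK_wedgeF_sums) (simp_all add: A B gact_def act_def)
qed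

text \<open>This is the contribution of one factorisation of the group element. By
  \<open>alternating_product\<close> and \<open>Upsilon_alternating\<close> it is the wedge with
  \<open>g\<close> acting on coefficients only, and \<open>wedgeK_gactK\<close> allows the action on
  forms to be added.\<close>

lemma PhiStar_cup_term:
  assumes g: "g \<in> carrier G" and h: "h \<in> carrier G"
    and aZ: "\<alpha> \<in> Zset G \<rho> Hm p" and bZ: "\<beta> \<in> Zset G \<rho> Hm q"
  shows "(\<Sum>\<pi>\<in>{\<pi>. \<pi> permutes {..<p+q}}. of_int (sign \<pi>)
      * (Upsilon G \<rho> b p \<alpha> (\<lambda>i. lin (u (\<pi> i))) g phi
        * gact \<rho> g (Upsilon G \<rho> b q \<beta> (\<lambda>i. lin (u (\<pi> (i + p)))) h) phi))
    = wedgeK p q (\<alpha> g) (gactK G \<rho> g (\<beta> h)) u phi"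
proof -
  obtain M f Phi where \<alpha>: "\<And>m. m < M \<Longrightarrow> f m \<in> polys" "\<And>m. m < M \<Longrightarrow> top_slots g p (Phi m)"
    "\<And>u phi. \<alpha> g u phi = (\<Sum>m<(M::nat). f m phi * wedgeF (Phi m) p u)"
    using Zset_expansion[OF aZ g] by blast
  obtain L f' Psi where \<beta>: "\<And>m. m < L \<Longrightarrow> f' m \<in> polys" "\<And>m. m < L \<Longrightarrow> top_slots h q (Psi m)"
    "\<And>u phi. \<beta> h u phi = (\<Sum>m<(L::nat). f' m phi * wedgeF (Psi m) q u)"
    using Zset_expansion[OF bZ h] by blast
  let ?P = "\<lambda>m. {\<pi>. \<pi> permutes {..<m::nat}}"
  \<comment> \<open>Acting by \<open>g\<close> on a polynomial is evaluation at this point, so both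
    factors below are plain numbers.\<close>
  let ?phi' = "\<chi> i. pairing phi (\<rho> g *v axis i 1)"
  let ?F = "\<lambda>w. Upsilon G \<rho> b p \<alpha> (\<lambda>i. lin (w i)) g phi"
    and ?F' = "\<lambda>w. Upsilon G \<rho> b q \<beta> (\<lambda>i. lin (w i)) h ?phi'"
  have F: "?F v = ?F w" if "\<And>i. i < p \<Longrightarrow> v i = w i" for v w
    using that by (simp add: eigenbasis.Upsilon_lin[OF eigenbasis_at[OF g] g])
  have altF: "(\<Sum>\<sigma>\<in>?P p. of_int (sign \<sigma>) * ?F (\<lambda>i. u (\<pi> (\<sigma> i)))) = \<alpha> g (\<lambda>i. u (\<pi> i)) phi" for \<pi>
    using eigenbasis.Upsilon_alternating[OF eigenbasis_at[OF g] g, where \<alpha> = \<alpha> and phi = phi and M = M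
        and c = "\<lambda>m. f m phi" and Phi = Phi and p = p and w = "\<lambda>i. u (\<pi> i)"] \<alpha>(3) by simp
  have altF': "(\<Sum>\<tau>\<in>?P q. of_int (sign \<tau>) * ?F' (\<lambda>i. u (\<pi> (\<tau> i + p))))
      = \<beta> h (\<lambda>i. u (\<pi> (i + p))) ?phi'" for \<pi>
    using eigenbasis.Upsilon_alternating[OF eigenbasis_at[OF h] h, where \<alpha> = \<beta> and phi = ?phi' and M = L
        and c = "\<lambda>m. f' m ?phi'" and Phi = Psi and p = q and w = "\<lambda>i. u (\<pi> (i + p))"] \<beta>(3) by simp
  have "(\<Sum>\<pi>\<in>?P (p + q). of_int (sign \<pi>) * \<alpha> g (\<lambda>i. u (\<pi> i)) phi * \<beta> h (\<lambda>i. u (\<pi> (i + p))) ?phi')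
    = of_nat (fact p * fact q) * (\<Sum>\<pi>\<in>?P (p + q). of_int (sign \<pi>)
      * ?F (\<lambda>i. u (\<pi> i)) * ?F' (\<lambda>i. u (\<pi> (i + p))))"
    unfolding altF[symmetric] altF'[symmetric]
    by (rule alternating_product[where F = ?F and F' = ?F' and u = u, OF F])
  then have eq: "wedgeK p q (\<alpha> g) (\<lambda>w. gact \<rho> g (\<beta> h w)) u phi
    = (\<Sum>\<pi>\<in>?P (p + q). of_int (sign \<pi>) * ?F (\<lambda>i. u (\<pi> i)) * ?F' (\<lambda>i. u (\<pi> (i + p))))"
    by (simp add: wedgeK_def gact_def act_def)
  have "wedgeK p q (\<alpha> g) (gactK G \<rho> g (\<beta> h)) u phi
    = wedgeK p q (\<alpha> g) (\<lambda>w. gact \<rho> g (\<beta> h w)) u phi"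
    by (rule trans[OF wedgeK_gactK(1)[OF g \<alpha>(3) \<alpha>(2) \<beta>(3)]
          wedgeK_gactK(2)[OF g \<alpha>(3) \<alpha>(2) \<beta>(3), symmetric]])
  then show ?thesis
    unfolding eq by (simp add: gact_def act_def mult.assoc)
qed

lemma wedgeK_gactK_in_Zg:
  assumes g: "g \<in> carrier G" and h: "h \<in> carrier G"
    and aZ: "\<alpha> \<in> Zset G \<rho> Hm p" and bZ: "\<beta> \<in> Zset G \<rho> Hm q"
  shows "wedgeK p q (\<alpha> g) (gactK G \<rho> g (\<beta> h)) \<in> Zg \<rho> Hm polys (g \<otimes>\<^bsub>G\<^esub> h) (p + q)"
    and "wedgeK p q (\<alpha> g) (\<beta> h) \<in> Zg \<rho> Hm polys (g \<otimes>\<^bsub>G\<^esub> h) (p + q)"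
    and "(\<lambda>u phi. wedgeK p q (\<alpha> g) (gactK G \<rho> g (\<beta> h)) u phi - wedgeK p q (\<alpha> g) (\<beta> h) u phi)
      \<in> Zg \<rho> Hm (idealI Hm (orth Hm (fixsp \<rho> (g \<otimes>\<^bsub>G\<^esub> h)))) (g \<otimes>\<^bsub>G\<^esub> h) (p + q)"
proof -
  obtain M f Phi where \<alpha>: "\<And>m. m < M \<Longrightarrow> f m \<in> polys" "\<And>m. m < M \<Longrightarrow> top_slots g p (Phi m)"
    "\<And>u phi. \<alpha> g u phi = (\<Sum>m<(M::nat). f m phi * wedgeF (Phi m) p u)"
    using Zset_expansion[OF aZ g] by blast
  obtain L f' Psi where \<beta>: "\<And>m. m < L \<Longrightarrow> f' m \<in> polys" "\<And>m. m < L \<Longrightarrow> top_slots h q (Psi m)"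
    "\<And>u phi. \<beta> h u phi = (\<Sum>m<(L::nat). f' m phi * wedgeF (Psi m) q u)"
    using Zset_expansion[OF bZ h] by blast
  let ?W = "\<lambda>m l. wedgeF (concat_forms p (Phi m) (Psi l)) (p + q)"
  have twisted: "wedgeK p q (\<alpha> g) (gactK G \<rho> g (\<beta> h))
      = (\<lambda>u phi. \<Sum>m<M. \<Sum>l<L. (f m phi * gact \<rho> g (f' l) phi) * ?W m l u)"
    by (intro ext wedgeK_gactK(1)[OF g \<alpha>(3) \<alpha>(2) \<beta>(3)])
  have plain: "wedgeK p q (\<alpha> g) (\<beta> h) = (\<lambda>u phi. \<Sum>m<M. \<Sum>l<L. (f m phi * f' l phi) * ?W m l u)"
    by (intro ext wedgeK_wedgeF_sums \<alpha>(3) \<beta>(3))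
  have scale: "(\<lambda>phi. c * r phi) \<in> polys" if "r \<in> polys" for r :: "'n spoly" and c
    using polys.mult[OF polys.const that] .
  show "wedgeK p q (\<alpha> g) (gactK G \<rho> g (\<beta> h)) \<in> Zg \<rho> Hm polys (g \<otimes>\<^bsub>G\<^esub> h) (p + q)"
    unfolding twisted
    by (intro Zg_sum product_in_Zg[OF g h] scale)
       (auto intro: \<alpha> \<beta> polys.mult gact_polys)
  show "wedgeK p q (\<alpha> g) (\<beta> h) \<in> Zg \<rho> Hm polys (g \<otimes>\<^bsub>G\<^esub> h) (p + q)"
    unfolding plain
    by (intro Zg_sum product_in_Zg[OF g h] scale)
       (auto intro: \<alpha> \<beta> polys.mult)
  \<comment> \<open>The forms agree in both expansions, so the difference sits entirely in the
    coefficients.\<close>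
  have diff: "(\<lambda>u phi. wedgeK p q (\<alpha> g) (gactK G \<rho> g (\<beta> h)) u phi - wedgeK p q (\<alpha> g) (\<beta> h) u phi)
      = (\<lambda>u phi. \<Sum>m<M. \<Sum>l<L. (f m phi * (gact \<rho> g (f' l) phi - f' l phi)) * ?W m l u)"
    unfolding twisted plain
    by (simp add: sum_subtractf[symmetric] algebra_simps)
  show "(\<lambda>u phi. wedgeK p q (\<alpha> g) (gactK G \<rho> g (\<beta> h)) u phi - wedgeK p q (\<alpha> g) (\<beta> h) u phi)
      \<in> Zg \<rho> Hm (idealI Hm (orth Hm (fixsp \<rho> (g \<otimes>\<^bsub>G\<^esub> h)))) (g \<otimes>\<^bsub>G\<^esub> h) (p + q)"
    unfolding diff
  proof (intro Zg_sum product_in_Zg[OF g h] idealI_scale)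
    fix m l assume ml: "m \<in> {..<M}" "l \<in> {..<L}"
    then show "top_slots g p (Phi m)" "top_slots h q (Psi l)" using \<alpha> \<beta> by auto
    assume "fixsp \<rho> (g \<otimes>\<^bsub>G\<^esub> h) \<subseteq> fixsp \<rho> g"
    \<comment> \<open>A smaller fixed space has a larger complement, so the ideal attached to
      \<open>g\<close> is contained in the one attached to the product.\<close>
    then have "orth Hm (fixsp \<rho> g) \<subseteq> orth Hm (fixsp \<rho> (g \<otimes>\<^bsub>G\<^esub> h))"
      by (auto simp: orth_def)
    then have "(\<lambda>phi. gact \<rho> g (f' l) phi - f' l phi) \<in> idealI Hm (orth Hm (fixsp \<rho> (g \<otimes>\<^bsub>G\<^esub> h)))"
      using gact_minus_in_ideal[OF g \<beta>(1)] ml idealI_mono by blast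
    then show "(\<lambda>phi. f m phi * (gact \<rho> g (f' l) phi - f' l phi))
        \<in> idealI Hm (orth Hm (fixsp \<rho> (g \<otimes>\<^bsub>G\<^esub> h)))"
      using idealI_mult \<alpha>(1) ml by blast
  qed
qed

section \<open>Summation over the group\<close>

lemma inv_mult_cancel:
  assumes "g \<in> carrier G" "k \<in> carrier G"
  shows "inv\<^bsub>G\<^esub> g \<otimes>\<^bsub>G\<^esub> k \<in> carrier G" "g \<otimes>\<^bsub>G\<^esub> (inv\<^bsub>G\<^esub> g \<otimes>\<^bsub>G\<^esub> k) = k"
proof -
  interpret group G by (rule grp)
  show "inv\<^bsub>G\<^esub> g \<otimes>\<^bsub>G\<^esub> k \<in> carrier G" "g \<otimes>\<^bsub>G\<^esub> (inv\<^bsub>G\<^esub> g \<otimes>\<^bsub>G\<^esub> k) = k"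
    using assms by (simp_all add: m_assoc[symmetric])
qed

lemma PhiStar_cup:
  assumes k: "k \<in> carrier G"
    and aZ: "\<alpha> \<in> Zset G \<rho> Hm p" and bZ: "\<beta> \<in> Zset G \<rho> Hm q"
  shows "PhiStar (p + q) (cupb G \<rho> p (Upsilon G \<rho> b p \<alpha>) (Upsilon G \<rho> b q \<beta>)) u k phi
    = diamond G \<rho> p q \<alpha> \<beta> k u phi"
proof -
  have "PhiStar (p + q) (cupb G \<rho> p (Upsilon G \<rho> b p \<alpha>) (Upsilon G \<rho> b q \<beta>)) u k phi
    = (\<Sum>g\<in>carrier G. \<Sum>\<pi>\<in>{\<pi>. \<pi> permutes {..<p+q}}. of_int (sign \<pi>)
      * (Upsilon G \<rho> b p \<alpha> (\<lambda>i. lin (u (\<pi> i))) g phi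
        * gact \<rho> g (Upsilon G \<rho> b q \<beta> (\<lambda>i. lin (u (\<pi> (i + p)))) (inv\<^bsub>G\<^esub> g \<otimes>\<^bsub>G\<^esub> k)) phi))"
    unfolding PhiStar_def cupb_def smash_mult_def sum_distrib_left by (rule sum.swap)
  also have "\<dots> = diamond G \<rho> p q \<alpha> \<beta> k u phi"
    unfolding diamond_def
    by (intro sum.cong refl PhiStar_cup_term inv_mult_cancel aZ bZ k)
  finally show ?thesis .
qed

lemma diamond_in_Zset:
  assumes aZ: "\<alpha> \<in> Zset G \<rho> Hm p" and bZ: "\<beta> \<in> Zset G \<rho> Hm q"
  shows "diamond G \<rho> p q \<alpha> \<beta> \<in> Zset G \<rho> Hm (p + q)"
  unfolding Zset_def
proof (intro CollectI ballI)
  fix k assume k: "k \<in> carrier G"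
  show "diamond G \<rho> p q \<alpha> \<beta> k \<in> Zg \<rho> Hm polys k (p + q)"
    unfolding diamond_def
  proof (rule Zg_sum)
    fix g assume "g \<in> carrier G"
    then show "wedgeK p q (\<alpha> g) (gactK G \<rho> g (\<beta> (inv\<^bsub>G\<^esub> g \<otimes>\<^bsub>G\<^esub> k))) \<in> Zg \<rho> Hm polys k (p + q)"
      using wedgeK_gactK_in_Zg(1)[OF _ inv_mult_cancel(1) aZ bZ, of g g k] inv_mult_cancel(2) k by simp
  qed
qed

text \<open>Only the summand at \<open>g\<close> survives, and its second factor is nonzero only if
  g^-1 k = h.\<close>

lemma diamond_homogeneous:
  assumes g: "g \<in> carrier G" and h: "h \<in> carrier G" and k: "k \<in> carrier G"
    and \<alpha>: "\<And>x. x \<in> carrier G \<Longrightarrow> x \<noteq> g \<Longrightarrow> \<alpha> x = (\<lambda>u phi. 0)"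
    and \<beta>: "\<And>x. x \<in> carrier G \<Longrightarrow> x \<noteq> h \<Longrightarrow> \<beta> x = (\<lambda>u phi. 0)"
  shows "diamond G \<rho> p q \<alpha> \<beta> k u phi
    = (if k = g \<otimes>\<^bsub>G\<^esub> h then wedgeK p q (\<alpha> g) (gactK G \<rho> g (\<beta> h)) u phi else 0)"
proof -
  let ?t = "\<lambda>x. wedgeK p q (\<alpha> x) (gactK G \<rho> x (\<beta> (inv\<^bsub>G\<^esub> x \<otimes>\<^bsub>G\<^esub> k))) u phi"
  have "diamond G \<rho> p q \<alpha> \<beta> k u phi = (\<Sum>x\<in>carrier G. if x = g then ?t g else 0)"
    unfolding diamond_def
    by (intro sum.cong refl) (auto simp: \<alpha> wedgeK_def)
  also have "\<dots> = ?t g" using fin g by simp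
  also have "\<dots> = (if k = g \<otimes>\<^bsub>G\<^esub> h then wedgeK p q (\<alpha> g) (gactK G \<rho> g (\<beta> h)) u phi else 0)"
  proof (cases "k = g \<otimes>\<^bsub>G\<^esub> h")
    case True
    interpret group G by (rule grp)
    have "inv\<^bsub>G\<^esub> g \<otimes>\<^bsub>G\<^esub> k = h"
      using True g h by (simp add: m_assoc[symmetric])
    then show ?thesis using True by simp
  next
    case False
    then have "inv\<^bsub>G\<^esub> g \<otimes>\<^bsub>G\<^esub> k \<noteq> h" using inv_mult_cancel(2)[OF g k] by metis
    then have "\<beta> (inv\<^bsub>G\<^esub> g \<otimes>\<^bsub>G\<^esub> k) = (\<lambda>u phi. 0)"
      using \<beta> inv_mult_cancel(1)[OF g k] by blast
    then show ?thesis using False by (simp add: wedgeK_def gactK_def gact_def act_def)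
  qed
  finally show ?thesis .
qed

end

theorem theorem7p1:
  fixes G :: "'g monoid"
    and \<rho> :: "'g \<Rightarrow> complex^'n^'n"
    and Hm :: "complex^'n^'n"
    and b :: "'g \<Rightarrow> nat \<Rightarrow> complex^'n"
    and \<alpha> \<beta> :: "('g,'n) kcochain"
    and p q :: nat
  assumes grp: "group G" and fin: "finite (carrier G)"
    and rep_mult: "\<forall>x\<in>carrier G. \<forall>y\<in>carrier G. \<rho> (x \<otimes>\<^bsub>G\<^esub> y) = \<rho> x ** \<rho> y"
    and rep_one: "\<rho> \<one>\<^bsub>G\<^esub> = mat 1"
    and herm: "\<forall>i j. Hm $ i $ j = cnj (Hm $ j $ i)"
    and posdef: "\<forall>v. v \<noteq> 0 \<longrightarrow> 0 < Re (herm_ip Hm v v)"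
    and invariant: "\<forall>g\<in>carrier G. \<forall>v w. herm_ip Hm (\<rho> g *v v) (\<rho> g *v w) = herm_ip Hm v w"
    and eb: "eigenbases G \<rho> b"
    and aZ: "\<alpha> \<in> Zset G \<rho> Hm p"
    and bZ: "\<beta> \<in> Zset G \<rho> Hm q"
  shows "(\<forall>k\<in>carrier G. \<forall>u phi.
            PhiStar (p + q) (cupb G \<rho> p (Upsilon G \<rho> b p \<alpha>) (Upsilon G \<rho> b q \<beta>)) u k phi
            = diamond G \<rho> p q \<alpha> \<beta> k u phi)
       \<and> diamond G \<rho> p q \<alpha> \<beta> \<in> Zset G \<rho> Hm (p + q)
       \<and> (\<forall>g h fg fh \<omega>g \<omega>h. g \<in> carrier G \<and> h \<in> carrier G
            \<and> fg \<in> polys \<and> fh \<in> polys \<and> \<omega>g \<in> extp p \<and> \<omega>h \<in> extp q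
            \<and> (\<forall>k\<in>carrier G. \<alpha> k = (if k = g then (\<lambda>u phi. fg phi * \<omega>g u) else (\<lambda>u phi. 0)))
            \<and> (\<forall>k\<in>carrier G. \<beta> k = (if k = h then (\<lambda>u phi. fh phi * \<omega>h u) else (\<lambda>u phi. 0)))
          \<longrightarrow> (let X = (\<lambda>k u phi. if k = g \<otimes>\<^bsub>G\<^esub> h
                          then fg phi * fh phi * wedgeS p q \<omega>g \<omega>h u else 0)
               in X \<in> Zset G \<rho> Hm (p + q)
                  \<and> (\<lambda>k u phi. diamond G \<rho> p q \<alpha> \<beta> k u phi - X k u phi) \<in> Bset G \<rho> Hm (p + q)))"
proof -
  interpret unitary_rep G \<rho> Hm b
    using grp fin rep_mult rep_one herm posdef invariant eb by (rule unitary_rep.intro)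
  show ?thesis
  proof (intro conjI allI impI ballI; (elim conjE)?)
    fix k u phi assume "k \<in> carrier G"
    then show "PhiStar (p + q) (cupb G \<rho> p (Upsilon G \<rho> b p \<alpha>) (Upsilon G \<rho> b q \<beta>)) u k phi
      = diamond G \<rho> p q \<alpha> \<beta> k u phi"
      using PhiStar_cup aZ bZ by blast
  next
    show "diamond G \<rho> p q \<alpha> \<beta> \<in> Zset G \<rho> Hm (p + q)"
      using diamond_in_Zset[OF aZ bZ] .
  next
    fix g h fg fh \<omega>g \<omega>h
    assume g: "g \<in> carrier G" and h: "h \<in> carrier G"
      and \<alpha>: "\<forall>k\<in>carrier G. \<alpha> k = (if k = g then (\<lambda>u phi. fg phi * \<omega>g u) else (\<lambda>u phi. 0))"
      and \<beta>: "\<forall>k\<in>carrier G. \<beta> k = (if k = h then (\<lambda>u phi. fh phi * \<omega>h u) else (\<lambda>u phi. 0))"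
    let ?X = "\<lambda>k u phi. if k = g \<otimes>\<^bsub>G\<^esub> h then fg phi * fh phi * wedgeS p q \<omega>g \<omega>h u else 0"
    \<comment> \<open>Coefficient and form of each factor are separated here, so the tensor product
      multiplication is the untwisted wedge of the two components.\<close>
    have X: "?X k = (if k = g \<otimes>\<^bsub>G\<^esub> h then wedgeK p q (\<alpha> g) (\<beta> h) else (\<lambda>u phi. 0))" for k
    proof (cases "k = g \<otimes>\<^bsub>G\<^esub> h")
      case True
      have "fg phi * fh phi * wedgeS p q \<omega>g \<omega>h u = wedgeK p q (\<alpha> g) (\<beta> h) u phi" for u phi
        using \<alpha> \<beta> g h by (simp add: wedgeS_def wedgeK_def sum_distrib_left mult_ac)
      then show ?thesis using True by simp
    qed simp
    have diamond: "diamond G \<rho> p q \<alpha> \<beta> k u phi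
        = (if k = g \<otimes>\<^bsub>G\<^esub> h then wedgeK p q (\<alpha> g) (gactK G \<rho> g (\<beta> h)) u phi else 0)"
      if "k \<in> carrier G" for k u phi
      using diamond_homogeneous[OF g h that] \<alpha> \<beta> by simp
    have XZ: "?X \<in> Zset G \<rho> Hm (p + q)"
      unfolding Zset_def X using wedgeK_gactK_in_Zg(2)[OF g h aZ bZ] by (simp add: Zg_0)
    moreover have "(\<lambda>k u phi. diamond G \<rho> p q \<alpha> \<beta> k u phi - ?X k u phi) \<in> Bset G \<rho> Hm (p + q)"
      unfolding Bset_def
    proof (intro CollectI ballI)
      fix k assume k: "k \<in> carrier G"
      have "(\<lambda>u phi. diamond G \<rho> p q \<alpha> \<beta> k u phi - ?X k u phi)
        = (if k = g \<otimes>\<^bsub>G\<^esub> h then (\<lambda>u phi. wedgeK p q (\<alpha> g) (gactK G \<rho> g (\<beta> h)) u phi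
            - wedgeK p q (\<alpha> g) (\<beta> h) u phi) else (\<lambda>u phi. 0))"
        by (simp add: fun_cong[OF fun_cong[OF X]] diamond[OF k])
      then show "(\<lambda>u phi. diamond G \<rho> p q \<alpha> \<beta> k u phi - ?X k u phi)
          \<in> Zg \<rho> Hm (idealI Hm (orth Hm (fixsp \<rho> k))) k (p + q)"
        using wedgeK_gactK_in_Zg(3)[OF g h aZ bZ] by (simp add: Zg_0)
    qed
    ultimately show "let X = ?X in X \<in> Zset G \<rho> Hm (p + q)
        \<and> (\<lambda>k u phi. diamond G \<rho> p q \<alpha> \<beta> k u phi - X k u phi) \<in> Bset G \<rho> Hm (p + q)"
      by simp
  qed
qed

end
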